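(* Fix positive integers $n',n''$, set $n=n'+n''$, and fix multiindices $\alpha',\beta'$ of length $n'$ and $\alpha''$ of length $n''$, all with positive integer entries. Let $K_1$ be the least common multiple of the entries of $\alpha',\alpha''$ and $\beta'$, and let $K_2$ be the number of distinct values modulo $K_1$ taken by the sums $\alpha'_i+\beta'_j$ for $i,j=1,\dots,n'$. Then there is a set $E$ of multiindices of length $n''$ of lower density $K_1^{-n''}$ such that for every $\beta''\in E$ and every positive integer $r$ with $$r<n'-\sqrt{(1-K_2^{-1})(n')^2+2n},$$ a generic element $(p_1,\dots,p_{n''})$ of $\Lambda_{\alpha,\beta}$ satisfies the rank condition: for every $(x',x'',y')\in(\mathbb{R}^{n'}\times\mathbb{R}^{n''}\times\mathbb{R}^{n'})\setminus\{0\}$ and every $\eta''\in\mathbb{R}^{n''}\setminus\{0\}$, the $n'\times n'$ matrix with $(i,j)$-entry $$\frac{\partial^2}{\partial x'_i\,\partial y'_j}\sum_{l=1}^{n''}\eta''_l\,p_l(x',x'',y')$$ has rank at least $r$.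
   Context: For a tuple of integers (multiindex) $\gamma=(\gamma_1,\dots,\gamma_m)$, $z\in\mathbb{R}^m$ and an integer $j$, write $2^{j\gamma}z:=(2^{j\gamma_1}z_1,\dots,2^{j\gamma_m}z_m)$. A set $E$ of multiindices of length $n''$ (with positive integer entries) is said to have lower density $\epsilon$ if $$\liminf_{N\to\infty}\frac{\#\{\beta''\in E:\ \beta''_i\le N\ \ \forall i=1,\dots,n''\}}{N^{n''}}\ge\epsilon.$$ With $\alpha=(\alpha',\alpha'')$ and $\beta=(\beta',\beta'')$, $\Lambda_{\alpha,\beta}$ is the space of all $n''$-tuples $(p_1,\dots,p_{n''})$ of real polynomials in the variables $x'\in\mathbb{R}^{n'}$, $x''\in\mathbb{R}^{n''}$, $y'\in\mathbb{R}^{n'}$ such that $$p_l(2^{j\alpha'}x',2^{j\alpha''}x'',2^{j\beta'}y')=2^{j\beta''_l}p_l(x',x'',y')$$ for each integer $j$ and each $l=1,\dots,n''$. It is a finite-dimensional real vector space and is given its usual topology. "A generic element of $\Lambda_{\alpha,\beta}$ has a property" means that the set of elements having the property contains an open dense subset of $\Lambda_{\alpha,\beta}$. (Each element $(p_1,\dots,p_{n''})$, viewed as a map $S=(p_1,\dots,p_{n''})$, induces the averaging operator $Tf(x',x'')=\int f(y',x''+S(x',x'',y'))\psi(x',x'',y')\,dy'$; the displayed matrix is its mixed Hessian.) *)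

theory Defs
  imports "HOL-Analysis.Analysis"
begin

text \<open>
  Multiindices of length \<open>n'\<close> and \<open>n''\<close> are vectors of type \<^typ>\<open>nat ^ 'm\<close> and \<^typ>\<open>nat ^ 'k\<close> with
  \<open>n' = CARD('m)\<close> and \<open>n'' = CARD('k)\<close>.
\<close>

type_synonym ('m, 'k) pt = "(real ^ 'm) \<times> (real ^ 'k) \<times> (real ^ 'm)"

definition dilate :: "int \<Rightarrow> nat ^ 'a \<Rightarrow> real ^ 'a \<Rightarrow> real ^ 'a" where
  "dilate j \<gamma> z = (\<chi> i. 2 powi (j * int (\<gamma> $ i)) * z $ i)"

definition has_lower_density :: "(nat ^ 'k::finite) set \<Rightarrow> real \<Rightarrow> bool" where
  "has_lower_density E \<epsilon> \<longleftrightarrow>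
     (\<forall>\<beta>\<in>E. \<forall>i. \<beta> $ i > 0) \<and>
     ereal \<epsilon> \<le> liminf (\<lambda>N. ereal (real (card {\<beta> \<in> E. \<forall>i. \<beta> $ i \<le> N}) / real N ^ CARD('k)))"

text \<open>
  Real polynomials are identified with the functions they induce, which loses nothing over the
  infinite field of real numbers.
\<close>

definition Lambda ::
  "nat ^ 'm \<Rightarrow> nat ^ 'k \<Rightarrow> nat ^ 'm \<Rightarrow> nat ^ 'k \<Rightarrow> (('m::finite, 'k::finite) pt \<Rightarrow> real ^ 'k) set"
  where
  "Lambda \<alpha>' \<alpha>'' \<beta>' \<beta>'' =
     {p. \<forall>l. real_polynomial_function (\<lambda>z. p z $ l) \<and>
           (\<forall>j x' x'' y'.
              p (dilate j \<alpha>' x', dilate j \<alpha>'' x'', dilate j \<beta>' y') $ l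
                = 2 powi (j * int (\<beta>'' $ l)) * p (x', x'', y') $ l)}"

text \<open>
  For \<open>V = Lambda \<alpha>' \<alpha>'' \<beta>' \<beta>''\<close> the topology \<^term>\<open>top_of_set V\<close> is that of pointwise convergence
  (inherited from the product topology on functions). It is a Hausdorff vector space topology, and
  since this space is finite-dimensional it is the usual one, i.e. that of convergence of the
  coefficients.
\<close>

definition generic :: "'a::topological_space set \<Rightarrow> ('a \<Rightarrow> bool) \<Rightarrow> bool" where
  "generic V P \<longleftrightarrow>
     (\<exists>U. openin (top_of_set V) U \<and> V \<subseteq> closure U \<and> U \<subseteq> {v \<in> V. P v})"

definition mixed_hessian ::
  "(('m::finite, 'k::finite) pt \<Rightarrow> real) \<Rightarrow> ('m, 'k) pt \<Rightarrow> real ^ 'm ^ 'm" where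
  "mixed_hessian \<phi> = (\<lambda>(x', x'', y'). \<chi> i j.
     deriv (\<lambda>s. deriv (\<lambda>t. \<phi> (x' + s *\<^sub>R axis i 1, x'', y' + t *\<^sub>R axis j 1)) 0) 0)"

definition rank_condition ::
  "nat \<Rightarrow> (('m::finite, 'k::finite) pt \<Rightarrow> real ^ 'k) \<Rightarrow> bool" where
  "rank_condition r p \<longleftrightarrow>
     (\<forall>z \<eta>. z \<noteq> 0 \<longrightarrow> \<eta> \<noteq> 0 \<longrightarrow>
        r \<le> rank (mixed_hessian (\<lambda>w. \<Sum>l\<in>UNIV. \<eta> $ l * p w $ l) z))"

definition K1 :: "nat ^ 'm \<Rightarrow> nat ^ 'k \<Rightarrow> nat ^ 'm \<Rightarrow> nat" where
  "K1 \<alpha>' \<alpha>'' \<beta>' = Lcm (range (($) \<alpha>') \<union> range (($) \<alpha>'') \<union> range (($) \<beta>'))"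

definition K2 :: "nat ^ 'm \<Rightarrow> nat ^ 'k \<Rightarrow> nat ^ 'm \<Rightarrow> nat" where
  "K2 \<alpha>' \<alpha>'' \<beta>' = card (range (\<lambda>(i, j). (\<alpha>' $ i + \<beta>' $ j) mod K1 \<alpha>' \<alpha>'' \<beta>'))"

end

theory Submission
  imports Defs
begin

text \<open>
  By the pigeonhole principle some residue class \<open>c\<close> modulo \<open>K\<^sub>1\<close> contains \<open>\<alpha>'\<^sub>i + \<beta>'\<^sub>j\<close> for a set \<open>P\<close> of
  at least \<open>n'\<^sup>2 / K\<^sub>2\<close> pairs \<open>(i, j)\<close>. Let \<open>E\<close> consist of the multiindices with all entries large and
  congruent to \<open>c\<close>. For \<open>\<beta>'' \<in> E\<close>, \<open>(i, j) \<in> P\<close> and every variable \<open>v\<close>, some monomial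
  \<open>x'\<^sub>i y'\<^sub>j v\<^sup>n\<close> has the weight \<open>\<beta>''\<^sub>l\<close>. Hence at a point with \<open>v \<noteq> 0\<close> the entries of the mixed
  Hessian indexed by \<open>P\<close> can be prescribed freely by adding such monomials to \<open>p\<^sub>l\<close>. The matrices of
  rank \<open>k < r\<close> form a family of dimension \<open>n'\<^sup>2 - (n' - k)\<^sup>2\<close>, and the points and the covectors \<open>\<eta>''\<close>
  contribute at most \<open>2n\<close> further parameters, so if \<open>n'\<^sup>2 - (n' - r)\<^sup>2 + 2n < card P\<close> then the
  coefficients for which the rank condition fails are a null set; in particular the good elements
  are dense. They form an open set because \<open>\<Lambda>\<close> is finite-dimensional and, by quasihomogeneity, the
  condition need only be checked on a compact set.
\<close>

section \<open>Negligible images of low-dimensional sets\<close>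

text \<open>The ambient space of \<open>S\<close> may have larger dimension than the target, where
  differentiable maps need not preserve null sets. So \<open>T\<close> is replaced by a linear copy
  \<open>W\<close> inside the target, which is null there because its dimension is too
  small.\<close>

lemma negligible_differentiable_image_subspace:
  fixes f :: "'a::euclidean_space \<Rightarrow> 'b::euclidean_space"
  assumes f: "f differentiable_on S" and "S \<subseteq> T" "subspace T" and dim: "dim T < DIM('b)"
  shows "negligible (f ` S)"
proof -
  obtain W :: "'b set" where W: "subspace W" "dim W = dim T"
    using choose_subspace_of_subspace[of "dim T" "UNIV :: 'b set"] dim by (auto simp: dim_UNIV)
  obtain g h where g: "linear g" "g ` W = T"
    using isometries_subspaces[OF W(1) \<open>subspace T\<close> W(2)] by metis
  let ?W = "W \<inter> g -` S"
  have "negligible ?W"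
    using negligible_subset[OF negligible_lowdim[of W]] W(2) dim by simp
  moreover have "(f \<circ> g) differentiable_on ?W"
    by (rule differentiable_on_compose[OF linear_imp_differentiable_on[OF g(1)], unfolded o_def[symmetric]])
      (auto intro: differentiable_on_subset[OF f])
  ultimately have "negligible ((f \<circ> g) ` ?W)"
    by (intro negligible_differentiable_image_negligible) auto
  moreover have "f ` S \<subseteq> (f \<circ> g) ` ?W"
  proof clarify
    fix x assume "x \<in> S"
    then obtain w where "w \<in> W" "x = g w" using g(2) \<open>S \<subseteq> T\<close> by blast
    then show "f x \<in> (f \<circ> g) ` ?W" using \<open>x \<in> S\<close> by auto
  qed
  ultimately show ?thesis
    using negligible_subset by blast
qed

lemma differentiable_on_prod:
  fixes f :: "'i \<Rightarrow> 'a::real_normed_vector \<Rightarrow> real"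
  assumes "\<And>i. i \<in> I \<Longrightarrow> f i differentiable_on S"
  shows "(\<lambda>x. \<Prod>i\<in>I. f i x) differentiable_on S"
  using assms by (induction I rule: infinite_finite_induct) auto

lemma differentiable_on_sum:
  fixes f :: "'i \<Rightarrow> 'a::real_normed_vector \<Rightarrow> 'b::real_normed_vector"
  assumes "\<And>i. i \<in> I \<Longrightarrow> f i differentiable_on S"
  shows "(\<lambda>x. \<Sum>i\<in>I. f i x) differentiable_on S"
  using assms by (induction I rule: infinite_finite_induct) auto

lemma differentiable_on_det:
  fixes A :: "'a::real_normed_vector \<Rightarrow> real^'n^'n"
  assumes "\<And>i j. (\<lambda>x. A x $ i $ j) differentiable_on S"
  shows "(\<lambda>x. det (A x)) differentiable_on S"
  unfolding det_def
  by (intro differentiable_on_sum differentiable_on_mult differentiable_on_prod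
      differentiable_on_const assms)

lemma differentiable_on_vec:
  fixes f :: "'a::real_normed_vector \<Rightarrow> real^'n"
  assumes "\<And>i. (\<lambda>x. f x $ i) differentiable_on S"
  shows "f differentiable_on S"
  using assms unfolding differentiable_on_def
  by (subst differentiable_componentwise_within) (auto simp: Basis_vec_def inner_axis)

section \<open>Overdetermined linear systems with parameters\<close>

lemma det_ne_0_if_kernel_trivial:
  fixes A :: "real^'n^'n"
  assumes "\<And>x. A *v x = 0 \<Longrightarrow> x = 0"
  shows "det A \<noteq> 0"
  using assms by (metis invertible_det_nz invertible_left_inverse matrix_left_invertible_ker)

lemma subspace_coordinates: "subspace {x :: real^'n. \<forall>i. i \<notin> d \<longrightarrow> x $ i = 0}"
  by (auto simp: subspace_def)

lemma dim_coordinates: "dim {x :: real^'n. \<forall>i. i \<notin> d \<longrightarrow> x $ i = 0} = card d"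
  using dim_substandard_cart[where 'a=real and 'n='n] by (simp add: dim_vec_eq)

text \<open>
  By Cramer's rule, the coordinates of \<open>c\<close> in \<open>I\<close> are differentiable functions of \<open>s\<close> and of the
  remaining coordinates, so the solutions form the image of a set of dimension
  \<open>dim T + (CARD('c) - card I) < CARD('c)\<close>.
\<close>
lemma negligible_overdetermined:
  fixes A :: "'c::finite \<Rightarrow> 'c \<Rightarrow> 'a::euclidean_space \<Rightarrow> real"
  assumes dA: "\<And>e e'. e \<in> I \<Longrightarrow> A e e' differentiable_on S"
    and db: "\<And>e. e \<in> I \<Longrightarrow> b e differentiable_on S"
    and T: "S \<subseteq> T" "subspace T" "dim T < card I"
    and inj: "\<And>s x. s \<in> S \<Longrightarrow> (\<And>e. e \<notin> I \<Longrightarrow> x e = 0) \<Longrightarrow>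
        (\<And>e. e \<in> I \<Longrightarrow> (\<Sum>e'\<in>UNIV. A e e' s * x e') = 0) \<Longrightarrow> x = (\<lambda>e. 0)"
  shows "negligible {c :: real^'c. \<exists>s\<in>S. \<forall>e\<in>I. (\<Sum>e'\<in>UNIV. A e e' s * c $ e') = b e s}"
proof -
  \<comment> \<open>The rows outside \<open>I\<close> are completed by rows of the identity. The
    equations become the square system \<open>B s *v c = h (s, c)\<close>, invertible by
    \<open>inj\<close>, and \<open>f\<close> below is Cramer's rule for it.\<close>
  define B :: "'a \<Rightarrow> real^'c^'c" where
    "B = (\<lambda>s. \<chi> e e'. if e \<in> I then A e e' s else if e' = e then 1 else 0)"
  define h :: "'a \<times> (real^'c) \<Rightarrow> real^'c" where
    "h = (\<lambda>(s,c). \<chi> e. if e \<in> I then b e s else c $ e)"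
  define f :: "'a \<times> (real^'c) \<Rightarrow> real^'c" where
    "f = (\<lambda>u. \<chi> k. det (\<chi> i j. if j = k then h u $ i else B (fst u) $ i $ j) / det (B (fst u)))"
  define Z :: "(real^'c) set" where "Z = {c. \<forall>e. e \<notin> - I \<longrightarrow> c $ e = 0}"
  have row: "(B s *v c) $ e = (if e \<in> I then \<Sum>e'\<in>UNIV. A e e' s * c $ e' else c $ e)" for s c e
    by (auto simp: matrix_vector_mult_def B_def if_distrib[of "\<lambda>x. x * _"] cong: if_cong)
  have det: "det (B s) \<noteq> 0" if "s \<in> S" for s
  proof (rule det_ne_0_if_kernel_trivial)
    fix x assume "B s *v x = 0"
    then have *: "(if e \<in> I then \<Sum>e'\<in>UNIV. A e e' s * x $ e' else x $ e) = 0" for e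
      by (metis row zero_index)
    have "($) x = (\<lambda>e. 0)"
      by (rule inj[OF that]) (use * in \<open>metis (full_types)\<close>)+
    then show "x = 0" by (metis vec_eq_iff zero_index)
  qed
  have fst_d: "(\<lambda>u. g (fst u)) differentiable_on (S \<times> Z)" if "g differentiable_on S" for g :: "'a \<Rightarrow> real"
    by (rule differentiable_on_compose[where g=fst])
      (auto intro: differentiable_on_subset[OF that] linear_imp_differentiable_on linear_fst)
  have dB: "(\<lambda>u. B (fst u) $ i $ j) differentiable_on (S \<times> Z)" for i j
    by (cases "i \<in> I") (auto simp: B_def intro!: fst_d dA)
  have dsnd: "(\<lambda>u. snd u $ i) differentiable_on (S \<times> Z)" for i
    by (intro bounded_linear_imp_differentiable_on bounded_linear_compose[OF bounded_linear_vec_nth bounded_linear_snd, unfolded o_def])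
  have dh: "(\<lambda>u. h u $ i) differentiable_on (S \<times> Z)" for i
    using fst_d[OF db] dsnd by (cases "i \<in> I") (auto simp: h_def case_prod_beta)
  have df: "f differentiable_on (S \<times> Z)"
  proof (rule differentiable_on_vec)
    fix k
    have "(\<lambda>u. det (\<chi> i j. if j = k then h u $ i else B (fst u) $ i $ j)) differentiable_on (S \<times> Z)"
    proof (rule differentiable_on_det)
      fix i j
      show "(\<lambda>u. (\<chi> i j. if j = k then h u $ i else B (fst u) $ i $ j) $ i $ j) differentiable_on (S \<times> Z)"
        using dh dB by (cases "j = k") simp_all
    qed
    moreover have "(\<lambda>u. inverse (det (B (fst u)))) differentiable_on (S \<times> Z)"
      by (rule differentiable_on_inverse[OF differentiable_on_det]) (use dB det in auto)
    ultimately show "(\<lambda>u. f u $ k) differentiable_on (S \<times> Z)"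
      by (simp add: f_def divide_inverse)
  qed
  have Z: "subspace Z" "dim Z = CARD('c) - card I"
    unfolding Z_def
    using subspace_coordinates[of "- I"] dim_coordinates[of "- I"]
    by (auto simp: card_Diff_subset Compl_eq_Diff_UNIV)
  have "card I \<le> CARD('c)" by (simp add: card_mono)
  have "negligible (f ` (S \<times> Z))"
  proof (rule negligible_differentiable_image_subspace[OF df])
    show "S \<times> Z \<subseteq> T \<times> Z" using T by auto
    show "subspace (T \<times> Z)" by (rule subspace_Times[OF T(2) Z(1)])
    have "dim (T \<times> Z) = dim T + dim Z" by (rule dim_Times[OF T(2) Z(1)])
    then show "dim (T \<times> Z) < DIM(real^'c)" using T(3) Z \<open>card I \<le> CARD('c)\<close> by simp
  qed
  moreover have "{c. \<exists>s\<in>S. \<forall>e\<in>I. (\<Sum>e'\<in>UNIV. A e e' s * c $ e') = b e s} \<subseteq> f ` (S \<times> Z)"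
  proof clarify
    fix c :: "real^'c" and s assume s: "s \<in> S" "\<forall>e\<in>I. (\<Sum>e'\<in>UNIV. A e e' s * c $ e') = b e s"
    \<comment> \<open>\<open>h\<close> ignores the coordinates of its vector argument in
      \<open>I\<close>; setting them to 0 puts this argument into the low-dimensional
      \<open>Z\<close>.\<close>
    define c0 :: "real^'c" where "c0 = (\<chi> e. if e \<in> I then 0 else c $ e)"
    have "B s *v c = h (s, c0)"
      using s(2) by (simp add: vec_eq_iff row h_def c0_def)
    then have "c = f (s, c0)"
      unfolding f_def fst_conv by (subst (asm) cramer[OF det[OF s(1)]])
    moreover have "(s, c0) \<in> S \<times> Z" using s(1) by (auto simp: Z_def c0_def)
    ultimately show "c \<in> f ` (S \<times> Z)" by blast
  qed
  ultimately show ?thesis using negligible_subset by blast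
qed

section \<open>Matrices of bounded rank\<close>

lemma norm_matrix_vector_mult_le:
  fixes A :: "real^'n^'m"
  shows "norm (A *v x) \<le> norm A * norm x"
proof -
  have "norm (A *v x) = L2_set (\<lambda>i. norm (A $ i \<bullet> x)) UNIV"
    by (simp add: norm_vec_def matrix_vector_mul_component)
  also have "\<dots> \<le> L2_set (\<lambda>i. norm (A $ i) * norm x) UNIV"
    by (rule L2_set_mono) (auto simp: Cauchy_Schwarz_ineq2)
  also have "\<dots> = norm A * norm x"
    by (simp add: L2_set_left_distrib norm_vec_def)
  finally show ?thesis .
qed

text \<open>\<open>A\<close> is injective on its row space, which has dimension
  \<open>rank A\<close>, hence bounded below there by some \<open>e > 0\<close>. A perturbation
  smaller than \<open>e\<close> stays injective on that space, so the rank cannot drop.\<close>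

lemma open_rank_ge: "open {A :: real^'n^'m. r \<le> rank A}"
  unfolding open_dist
proof clarify
  fix A :: "real^'n^'m"
  assume r: "r \<le> rank A"
  define T where "T = span (rows A)"
  have T: "subspace T" "dim T = rank A"
    by (simp_all add: T_def row_rank_def)
  have "x = 0" if x: "x \<in> T" "A *v x = 0" for x
  proof -
    \<comment> \<open>A kernel vector is orthogonal to every row, hence to their span
      \<open>T\<close>; being in \<open>T\<close>, it is orthogonal to itself.\<close>
    have "A $ i \<bullet> x = 0" for i
      using x(2) by (metis matrix_vector_mul_component zero_index)
    then have "orthogonal x y" if "y \<in> rows A" for y
      using that by (auto simp: rows_def row_def orthogonal_def inner_commute)
    then have "orthogonal x x"
      using x(1) unfolding T_def by (rule orthogonal_to_span[rotated])
    then show ?thesis by (simp add: orthogonal_def)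
  qed
  then obtain e where e: "e > 0" "\<And>x. x \<in> T \<Longrightarrow> e * norm x \<le> norm (A *v x)"
    using injective_imp_isometric[OF closed_subspace[OF T(1)] T(1), of "(*v) A"] by auto
  have "r \<le> rank B" if B: "dist B A < e" for B
  proof -
    have inj: "x = 0" if x: "x \<in> T" "B *v x = 0" for x
    proof (rule ccontr)
      assume "x \<noteq> 0"
      have "e * norm x \<le> norm ((B - A) *v x)"
        using e(2)[OF x(1)] x(2) by (simp add: matrix_vector_mult_diff_rdistrib)
      also have "\<dots> \<le> norm (B - A) * norm x" by (rule norm_matrix_vector_mult_le)
      also have "\<dots> < e * norm x"
        using B \<open>x \<noteq> 0\<close> by (simp add: dist_norm)
      finally show False by simp
    qed
    have "inj_on ((*v) B) (span T)"
      using T(1) inj linear_injective_on_subspace_0[of "(*v) B" T]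
      by (auto simp: span_eq_iff[THEN iffD2])
    then have "dim ((*v) B ` T) = dim T"
      by (intro dim_image_eq) auto
    moreover have "dim ((*v) B ` T) \<le> rank B"
      unfolding rank_dim_range by (intro dim_subset) auto
    ultimately show ?thesis using r T(2) by simp
  qed
  then show "\<exists>e>0. \<forall>B. dist B A < e \<longrightarrow> B \<in> {A. r \<le> rank A}" using e(1) by blast
qed

text \<open>Row and column factors amount to multiplication by diagonal matrices on both sides. The
  factors may vanish, so only one inequality holds.\<close>

lemma rank_rescale_le:
  fixes A :: "real^'n^'m"
  shows "rank (\<chi> i j. d i * A $ i $ j * e j) \<le> rank A"
proof -
  define D :: "real^'m^'m" where "D = (\<chi> i j. if i = j then d i else 0)"
  define E :: "real^'n^'n" where "E = (\<chi> i j. if i = j then e i else 0)"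
  have "(\<chi> i j. d i * A $ i $ j * e j) = (D ** A) ** E"
    by (simp add: vec_eq_iff matrix_matrix_mult_def D_def E_def if_distrib if_distribR sum.delta cong: if_cong)
  then show ?thesis
    by (metis rank_mul_le_left rank_mul_le_right order_trans)
qed

text \<open>
  With \<open>J\<close> indexing a basis of the column space, the entries of \<open>w\<close> in the columns of \<open>J\<close> are
  those basis columns, and the entries in the rows of \<open>J\<close> outside these columns are the
  coefficients expressing the other columns. The entries off this cross are irrelevant, hence the
  dimension \<open>n^2 - (n - card J)^2\<close>.
\<close>
definition low_rank :: "'n::finite set \<Rightarrow> real^('n \<times> 'n) \<Rightarrow> 'n \<Rightarrow> 'n \<Rightarrow> real" where
  "low_rank J w i j = (if j \<in> J then w $ (i, j) else \<Sum>a\<in>J. w $ (i, a) * w $ (a, j))"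

lemma ex_low_rank:
  fixes A :: "real^'n^'n"
  obtains J w where "card J = rank A" "\<And>e. e \<notin> {(i, j). i \<in> J \<or> j \<in> J} \<Longrightarrow> w $ e = 0"
    "\<And>i j. A $ i $ j = low_rank J w i j"
proof -
  obtain B where B: "B \<subseteq> columns A" "independent B" "columns A \<subseteq> span B" "card B = rank A"
    using basis_exists[of "columns A"] unfolding column_rank_def by metis
  have "columns A = (\<lambda>j. column j A) ` UNIV" by (auto simp: columns_def)
  \<comment> \<open>Columns may coincide, so one index is selected for each basis column; this makes
    \<open>card J\<close> equal to the rank.\<close>
  then obtain J where J: "inj_on (\<lambda>j. column j A) J" "B = (\<lambda>j. column j A) ` J"
    using B(1) by (metis subset_image_inj)
  have "\<exists>u. column j A = (\<Sum>a\<in>J. u a *\<^sub>R column a A)" for j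
  proof -
    have "column j A \<in> span B" using B(3) by (auto simp: columns_def)
    then obtain v where "column j A = (\<Sum>b\<in>B. v b *\<^sub>R b)"
      using span_finite[of B] J(2) by auto
    then show ?thesis
      unfolding J(2) using sum.reindex[OF J(1)] by (intro exI[of _ "\<lambda>a. v (column a A)"]) (simp add: o_def)
  qed
  then obtain U where U: "\<And>j. column j A = (\<Sum>a\<in>J. U j a *\<^sub>R column a A)" by metis
  have U': "A $ i $ j = (\<Sum>a\<in>J. U j a * A $ i $ a)" for i j
  proof -
    have "A $ i $ j = column j A $ i" by (simp add: column_def)
    also have "\<dots> = (\<Sum>a\<in>J. U j a * A $ i $ a)"
      by (subst U) (simp add: column_def)
    finally show ?thesis .
  qed
  define w :: "real^('n \<times> 'n)" where
    "w = (\<chi> e. if snd e \<in> J then A $ fst e $ snd e else if fst e \<in> J then U (snd e) (fst e) else 0)"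
  show ?thesis
  proof
    show "card J = rank A" using J B(4) card_image by metis
    show "w $ e = 0" if "e \<notin> {(i, j). i \<in> J \<or> j \<in> J}" for e
      using that by (auto simp: w_def split: prod.splits)
    show "A $ i $ j = low_rank J w i j" for i j
      using U'[of i j] by (auto simp: low_rank_def w_def mult.commute intro!: sum.cong)
  qed
qed

text \<open>The cross misses exactly the square on the complement of \<open>J\<close>. The additive
  form avoids subtracting squares of natural numbers.\<close>

lemma card_cross:
  fixes J :: "'n::finite set"
  shows "card {(i, j). i \<in> J \<or> j \<in> J} + (CARD('n) - card J)\<^sup>2 = CARD('n)\<^sup>2"
proof -
  have "{(i, j). i \<in> J \<or> j \<in> J} = UNIV - (- J) \<times> (- J)" by auto
  then have "card {(i, j). i \<in> J \<or> j \<in> J} = CARD('n \<times> 'n) - card ((- J) \<times> (- J))"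
    by (simp add: card_Diff_subset del: card_prod)
  moreover have "card ((- J) \<times> (- J)) = (CARD('n) - card J)\<^sup>2"
    by (simp add: card_cartesian_product Compl_eq_Diff_UNIV card_Diff_subset power2_eq_square)
  moreover have "card ((- J) \<times> (- J)) \<le> CARD('n \<times> 'n)" by (rule card_mono) auto
  ultimately show ?thesis by (simp add: power2_eq_square)
qed

section \<open>Directional derivatives of polynomials and the mixed Hessian\<close>

text \<open>A relation rather than \<open>deriv\<close>, so that derivatives are computed by
  composing rules and differentiability comes with them.\<close>

definition has_dir_deriv ::
  "'a::real_normed_vector \<Rightarrow> ('a \<Rightarrow> real) \<Rightarrow> ('a \<Rightarrow> real) \<Rightarrow> bool" where
  "has_dir_deriv e p q \<longleftrightarrow> (\<forall>z. ((\<lambda>t. p (z + t *\<^sub>R e)) has_real_derivative q z) (at 0))"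

lemma has_dir_deriv_const: "has_dir_deriv e (\<lambda>z. c) (\<lambda>z. 0)"
  by (simp add: has_dir_deriv_def)

lemma has_dir_deriv_linear:
  assumes "linear f" shows "has_dir_deriv e f (\<lambda>z. f e)"
  using assms unfolding has_dir_deriv_def
  by (auto simp: linear_add linear_scale intro!: derivative_eq_intros)

lemma has_dir_deriv_add:
  "has_dir_deriv e p p' \<Longrightarrow> has_dir_deriv e q q' \<Longrightarrow> has_dir_deriv e (\<lambda>z. p z + q z) (\<lambda>z. p' z + q' z)"
  unfolding has_dir_deriv_def by (auto intro!: DERIV_add)

lemma has_dir_deriv_mult:
  "has_dir_deriv e p p' \<Longrightarrow> has_dir_deriv e q q' \<Longrightarrow>
    has_dir_deriv e (\<lambda>z. p z * q z) (\<lambda>z. p' z * q z + p z * q' z)"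
  unfolding has_dir_deriv_def
proof
  fix z
  assume "\<forall>z. ((\<lambda>t. p (z + t *\<^sub>R e)) has_real_derivative p' z) (at 0)"
    and "\<forall>z. ((\<lambda>t. q (z + t *\<^sub>R e)) has_real_derivative q' z) (at 0)"
  then show "((\<lambda>t. p (z + t *\<^sub>R e) * q (z + t *\<^sub>R e)) has_real_derivative p' z * q z + p z * q' z) (at 0)"
    using DERIV_mult[of "\<lambda>t. p (z + t *\<^sub>R e)" "p' z" 0 UNIV "\<lambda>t. q (z + t *\<^sub>R e)" "q' z"]
    by (simp add: algebra_simps)
qed

lemma has_dir_deriv_cmult: "has_dir_deriv e p p' \<Longrightarrow> has_dir_deriv e (\<lambda>z. c * p z) (\<lambda>z. c * p' z)"
  using has_dir_deriv_mult[OF has_dir_deriv_const, of e p p' c] by simp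

lemma has_dir_deriv_power:
  assumes "has_dir_deriv e p p'"
  shows "has_dir_deriv e (\<lambda>z. p z ^ n) (\<lambda>z. real n * p z ^ (n - 1) * p' z)"
proof (induction n)
  case 0 then show ?case using has_dir_deriv_const[of e 1] by simp
next
  case (Suc n)
  \<comment> \<open>For \<open>n = 0\<close> the truncated exponent \<open>n - 1\<close> is harmless
    because the factor \<open>real n\<close> vanishes.\<close>
  show ?case
    using has_dir_deriv_mult[OF assms Suc.IH]
    by (cases n) (auto simp: algebra_simps)
qed

lemma has_dir_deriv_sum:
  assumes "\<And>i. i \<in> I \<Longrightarrow> has_dir_deriv e (p i) (q i)"
  shows "has_dir_deriv e (\<lambda>z. \<Sum>i\<in>I. p i z) (\<lambda>z. \<Sum>i\<in>I. q i z)"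
  using assms
  by (induction I rule: infinite_finite_induct) (auto intro: has_dir_deriv_const has_dir_deriv_add)

text \<open>The derivative is again a polynomial, so differentiation can be repeated; this provides
  both derivatives in the mixed Hessian.\<close>

lemma real_polynomial_function_has_dir_deriv:
  assumes "real_polynomial_function p"
  obtains q where "real_polynomial_function q" "has_dir_deriv e p q"
  using assms
proof (induction arbitrary: thesis)
  case (linear f)
  show ?case
    by (rule linear.prems[OF real_polynomial_function.intros(2) has_dir_deriv_linear])
      (rule bounded_linear.linear[OF linear.hyps])
next
  case (const c)
  show ?case by (rule const[OF real_polynomial_function.intros(2) has_dir_deriv_const])
next
  case (add f g)
  obtain f' where f': "real_polynomial_function f'" "has_dir_deriv e f f'" using add.IH(1) by blast
  obtain g' where g': "real_polynomial_function g'" "has_dir_deriv e g g'" using add.IH(2) by blast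
  show ?case
    by (rule add.prems[OF real_polynomial_function.intros(3)[OF f'(1) g'(1)] has_dir_deriv_add[OF f'(2) g'(2)]])
next
  case (mult f g)
  obtain f' where f': "real_polynomial_function f'" "has_dir_deriv e f f'" using mult.IH(1) by blast
  obtain g' where g': "real_polynomial_function g'" "has_dir_deriv e g g'" using mult.IH(2) by blast
  show ?case
    by (rule mult.prems[OF _ has_dir_deriv_mult[OF f'(2) g'(2)]])
      (intro real_polynomial_function.intros(3,4) f'(1) g'(1) mult.hyps)
qed

definition x_dir :: "'m \<Rightarrow> ('m::finite, 'k::finite) pt" where "x_dir i = (axis i 1, 0, 0)"
definition y_dir :: "'m \<Rightarrow> ('m::finite, 'k::finite) pt" where "y_dir j = (0, 0, axis j 1)"

text \<open>Evaluates the nested \<open>deriv\<close>: the inner derivative in direction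
  \<open>y_dir j\<close> is known at every point, in particular along the line through
  \<open>z\<close> in direction \<open>x_dir i\<close>, where the outer derivative is taken.\<close>

lemma mixed_hessian_eq:
  assumes "has_dir_deriv (y_dir j) \<phi> q" "has_dir_deriv (x_dir i) q h"
  shows "mixed_hessian \<phi> z $ i $ j = h z"
proof -
  obtain x u y where z: "z = (x, u, y)" by (cases z)
  have "deriv (\<lambda>t. \<phi> (x + s *\<^sub>R axis i 1, u, y + t *\<^sub>R axis j 1)) 0 = q (x + s *\<^sub>R axis i 1, u, y)" for s
    using assms(1)[unfolded has_dir_deriv_def, THEN spec, of "(x + s *\<^sub>R axis i 1, u, y)", THEN DERIV_imp_deriv]
    by (simp add: y_dir_def)
  moreover have "deriv (\<lambda>s. q (x + s *\<^sub>R axis i 1, u, y)) 0 = h (x, u, y)"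
    using assms(2)[unfolded has_dir_deriv_def, THEN spec, of "(x, u, y)", THEN DERIV_imp_deriv]
    by (simp add: x_dir_def)
  ultimately show ?thesis by (simp add: mixed_hessian_def z)
qed

lemma real_polynomial_function_mixed_hessian:
  assumes "real_polynomial_function \<phi>"
  obtains q h where "has_dir_deriv (y_dir j) \<phi> q" "has_dir_deriv (x_dir i) q h" "real_polynomial_function h"
proof -
  obtain q where q: "real_polynomial_function q" "has_dir_deriv (y_dir j) \<phi> q"
    using real_polynomial_function_has_dir_deriv[OF assms] by blast
  obtain h where "real_polynomial_function h" "has_dir_deriv (x_dir i) q h"
    using real_polynomial_function_has_dir_deriv[OF q(1)] by blast
  then show ?thesis using that q by blast
qed

lemma real_polynomial_function_mixed_hessian_entry:
  assumes "real_polynomial_function \<phi>"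
  shows "real_polynomial_function (\<lambda>z. mixed_hessian \<phi> z $ i $ j)"
proof -
  obtain q h where "has_dir_deriv (y_dir j) \<phi> q" "has_dir_deriv (x_dir i) q h"
    and h: "real_polynomial_function h"
    using real_polynomial_function_mixed_hessian[OF assms] by blast
  then have "(\<lambda>z. mixed_hessian \<phi> z $ i $ j) = h" by (intro ext mixed_hessian_eq)
  then show ?thesis using h by simp
qed

text \<open>Linearity rests on the existence of all derivatives involved, which polynomials
  guarantee.\<close>

lemma mixed_hessian_sum:
  assumes "\<And>a. a \<in> I \<Longrightarrow> real_polynomial_function (p a)"
  shows "mixed_hessian (\<lambda>z. \<Sum>a\<in>I. c a * p a z) z $ i $ j = (\<Sum>a\<in>I. c a * mixed_hessian (p a) z $ i $ j)"
proof -
  have "\<forall>a\<in>I. \<exists>q h. has_dir_deriv (y_dir j) (p a) q \<and> has_dir_deriv (x_dir i) q h"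
    using real_polynomial_function_mixed_hessian[OF assms] by (metis (no_types))
  then obtain q h where qh: "\<And>a. a \<in> I \<Longrightarrow> has_dir_deriv (y_dir j) (p a) (q a)"
      "\<And>a. a \<in> I \<Longrightarrow> has_dir_deriv (x_dir i) (q a) (h a)"
    by metis
  have "mixed_hessian (\<lambda>z. \<Sum>a\<in>I. c a * p a z) z $ i $ j = (\<Sum>a\<in>I. c a * h a z)"
    using qh by (intro mixed_hessian_eq[where q = "\<lambda>z. \<Sum>a\<in>I. c a * q a z"]
        has_dir_deriv_sum has_dir_deriv_cmult)
  then show ?thesis by (simp add: mixed_hessian_eq[OF qh])
qed

section \<open>Quasihomogeneous polynomials\<close>

text \<open>
  This makes the pointwise topology on a finite-dimensional space of polynomials manageable:
  an element and its derivatives depend continuously on its values at finitely many points.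
\<close>
lemma ex_reproducing_points:
  fixes g :: "'i \<Rightarrow> 'a::real_normed_vector \<Rightarrow> real"
  assumes "finite I" "\<And>i. i \<in> I \<Longrightarrow> real_polynomial_function (g i)"
  shows "\<exists>(N::nat) \<zeta> b. (\<forall>k<N. real_polynomial_function (b k)) \<and>
     (\<forall>a x. (\<Sum>i\<in>I. a i * g i x) = (\<Sum>k<N. (\<Sum>i\<in>I. a i * g i (\<zeta> k)) * b k x))"
  using assms
proof (induction I rule: finite_induct)
  case empty
  show ?case by (intro exI[of _ 0]) simp
next
  case (insert i0 I)
  then obtain N \<zeta> b where b: "\<And>k. k < (N::nat) \<Longrightarrow> real_polynomial_function (b k)"
    and rep: "\<And>a x. (\<Sum>i\<in>I. a i * g i x) = (\<Sum>k<N. (\<Sum>i\<in>I. a i * g i (\<zeta> k)) * b k x)"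
    by auto
  \<comment> \<open>The part of the new function \<open>g i0\<close> that the points found so far
    fail to reproduce.\<close>
  define h where "h = (\<lambda>x. g i0 x - (\<Sum>k<N. g i0 (\<zeta> k) * b k x))"
  have sum_insert: "(\<Sum>i\<in>insert i0 I. a i * g i x) = a i0 * g i0 x + (\<Sum>i\<in>I. a i * g i x)" for a x
    using insert.hyps by simp
  have h: "(\<Sum>i\<in>insert i0 I. a i * g i x)
      = (\<Sum>k<N. (\<Sum>i\<in>insert i0 I. a i * g i (\<zeta> k)) * b k x) + a i0 * h x" for a x
  proof -
    have "(\<Sum>k<N. (\<Sum>i\<in>insert i0 I. a i * g i (\<zeta> k)) * b k x)
        = a i0 * (\<Sum>k<N. g i0 (\<zeta> k) * b k x) + (\<Sum>k<N. (\<Sum>i\<in>I. a i * g i (\<zeta> k)) * b k x)"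
      by (simp only: sum_insert distrib_right sum.distrib sum_distrib_left mult.assoc)
    then show ?thesis
      by (simp only: sum_insert[of a x] h_def rep[of a x, symmetric] right_diff_distrib)
  qed
  have cmult: "real_polynomial_function (\<lambda>x. c * p x)" if "real_polynomial_function p"
    for c and p :: "'a \<Rightarrow> real"
    by (rule real_polynomial_function.intros(4)[OF real_polynomial_function.intros(2) that])
  have polh: "real_polynomial_function h"
    unfolding h_def
  proof (rule real_polynomial_function_diff)
    show "real_polynomial_function (g i0)" using insert.prems by blast
    show "real_polynomial_function (\<lambda>x. \<Sum>k<N. g i0 (\<zeta> k) * b k x)"
    proof (rule real_polynomial_function_sum)
      fix k assume "k \<in> {..<N}"
      then show "real_polynomial_function (\<lambda>x. g i0 (\<zeta> k) * b k x)"
        by (intro cmult b) simp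
    qed simp
  qed
  show ?case
  proof (cases "\<forall>x. h x = 0")
    case True
    have "(\<Sum>i\<in>insert i0 I. a i * g i x) = (\<Sum>k<N. (\<Sum>i\<in>insert i0 I. a i * g i (\<zeta> k)) * b k x)" for a x
      by (rule trans[OF h]) (simp only: True[rule_format] mult_zero_right add_0_right)
    then show ?thesis using b by blast
  next
    case False
    then obtain z0 where z0: "h z0 \<noteq> 0" by blast
    \<comment> \<open>The new point \<open>z0\<close> detects the coefficient of \<open>h\<close>:
      \<open>p z0\<close> minus the value predicted from the old points is
      \<open>a i0 * h z0\<close>. Dividing \<open>h\<close> by \<open>h z0\<close> gives the new
      function, and each old one is corrected by its own value at \<open>z0\<close>.\<close>
    define b' where "b' = (\<lambda>k x. if k < N then b k x - (b k z0 / h z0) * h x else inverse (h z0) * h x)"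
    define \<zeta>' where "\<zeta>' = \<zeta>(N := z0)"
    have "real_polynomial_function (b' k)" for k
    proof (cases "k < N")
      case True
      have "real_polynomial_function (\<lambda>x. b k x - (b k z0 / h z0) * h x)"
        by (rule real_polynomial_function_diff[OF b[OF True] cmult[OF polh]])
      then show ?thesis by (simp only: b'_def True if_True)
    next
      case False
      then show ?thesis using cmult[OF polh] by (simp only: b'_def if_False)
    qed
    moreover have "(\<Sum>i\<in>insert i0 I. a i * g i x)
        = (\<Sum>k<Suc N. (\<Sum>i\<in>insert i0 I. a i * g i (\<zeta>' k)) * b' k x)" for a x
    proof -
      define p where "p = (\<lambda>x. \<Sum>i\<in>insert i0 I. a i * g i x)"
      have p: "p x = (\<Sum>k<N. p (\<zeta> k) * b k x) + a i0 * h x" for x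
        unfolding p_def by (rule h)
      have "(\<Sum>k<Suc N. p (\<zeta>' k) * b' k x)
          = (\<Sum>k<N. p (\<zeta> k) * (b k x - (b k z0 / h z0) * h x)) + p z0 * (inverse (h z0) * h x)"
        by (simp add: b'_def \<zeta>'_def)
      also have "\<dots> = (\<Sum>k<N. p (\<zeta> k) * b k x) + (p z0 - (\<Sum>k<N. p (\<zeta> k) * b k z0)) * (h x / h z0)"
      proof -
        have "(\<Sum>k<N. p (\<zeta> k) * (b k x - (b k z0 / h z0) * h x))
            = (\<Sum>k<N. p (\<zeta> k) * b k x) - (\<Sum>k<N. p (\<zeta> k) * b k z0) * (h x / h z0)"
          by (simp add: right_diff_distrib sum_subtractf sum_distrib_right sum_divide_distrib mult.assoc)
        then show ?thesis by (simp add: left_diff_distrib divide_inverse)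
      qed
      also have "\<dots> = (\<Sum>k<N. p (\<zeta> k) * b k x) + a i0 * h x"
      proof -
        have "p z0 - (\<Sum>k<N. p (\<zeta> k) * b k z0) = a i0 * h z0"
          using p[of z0] by linarith
        then show ?thesis using z0 by simp
      qed
      also have "\<dots> = p x" by (rule p[symmetric])
      finally show ?thesis by (simp only: p_def)
    qed
    ultimately show ?thesis by blast
  qed
qed

section \<open>Expansion into weighted monomials\<close>

definition monomial :: "('a::euclidean_space \<Rightarrow> nat) \<Rightarrow> 'a \<Rightarrow> real" where
  "monomial m z = (\<Prod>b\<in>Basis. (z \<bullet> b) ^ m b)"

text \<open>A list may repeat exponents, so sums are concatenations and products need no normal
  form.\<close>

definition monomial_sum :: "(real \<times> ('a::euclidean_space \<Rightarrow> nat)) list \<Rightarrow> 'a \<Rightarrow> real" where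
  "monomial_sum L z = (\<Sum>(a, m)\<leftarrow>L. a * monomial m z)"

lemma monomial_sum_simps [simp]:
  "monomial_sum [] z = 0"
  "monomial_sum ((a, m) # L) z = a * monomial m z + monomial_sum L z"
  "monomial_sum (L @ L') z = monomial_sum L z + monomial_sum L' z"
  by (simp_all add: monomial_sum_def)

lemma monomial_sum_mult: "\<exists>L''. \<forall>z. monomial_sum L'' z = monomial_sum L z * monomial_sum L' z"
proof (induction L)
  case Nil
  show ?case by (intro exI[of _ "[]"]) simp
next
  case (Cons x L)
  obtain a m where x: "x = (a, m)" by (cases x)
  obtain L'' where L'': "\<And>z. monomial_sum L'' z = monomial_sum L z * monomial_sum L' z"
    using Cons by blast
  have "monomial_sum (map (\<lambda>(a', m'). (a * a', \<lambda>b. m b + m' b)) L') z = a * monomial m z * monomial_sum L' z" for z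
    by (induction L') (auto simp: algebra_simps monomial_def power_add prod.distrib)
  then show ?case
    by (intro exI[of _ "map (\<lambda>(a', m'). (a * a', \<lambda>b. m b + m' b)) L' @ L''"])
      (auto simp: x L'' algebra_simps)
qed

lemma real_polynomial_function_monomial_sum:
  assumes "real_polynomial_function (p :: 'a::euclidean_space \<Rightarrow> real)"
  shows "\<exists>L. \<forall>z. p z = monomial_sum L z"
  using assms
proof induction
  case (linear f)
  have *: "\<exists>L. \<forall>z. (\<Sum>b\<in>B. (z \<bullet> b) * f b) = monomial_sum L z" if "finite B" "B \<subseteq> Basis" for B :: "'a set"
    using that
  proof (induction B rule: finite_induct)
    case empty
    show ?case by (intro exI[of _ "[]"]) simp
  next
    case (insert b B)
    then obtain L where "\<And>z. (\<Sum>b\<in>B. (z \<bullet> b) * f b) = monomial_sum L z" by auto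
    moreover have "monomial (\<lambda>c. if c = b then 1 else 0) z = z \<bullet> b" for z
      using insert.prems by (simp add: monomial_def if_distrib[of "\<lambda>n. _ ^ n"] cong: if_cong)
    ultimately show ?case using insert.hyps
      by (intro exI[of _ "(f b, \<lambda>c. if c = b then 1 else 0) # L"]) (simp add: mult.commute)
  qed
  have "f z = (\<Sum>b\<in>Basis. (z \<bullet> b) * f b)" for z
  proof -
    have "f z = f (\<Sum>b\<in>Basis. (z \<bullet> b) *\<^sub>R b)" by (simp add: euclidean_representation)
    also have "\<dots> = (\<Sum>b\<in>Basis. (z \<bullet> b) * f b)"
      using bounded_linear.linear[OF linear] by (simp add: linear_sum linear_scale)
    finally show ?thesis .
  qed
  moreover obtain L where "\<And>z. (\<Sum>b\<in>Basis. (z \<bullet> b) * f b) = monomial_sum L z"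
    using *[OF finite_Basis subset_refl] by blast
  ultimately show ?case by metis
next
  case (const c)
  have "monomial (\<lambda>b. 0) z = 1" for z :: 'a by (simp add: monomial_def)
  then show ?case by (intro exI[of _ "[(c, \<lambda>b. 0)]"]) simp
next
  case (add f g)
  then show ?case by (metis monomial_sum_simps(3))
next
  case (mult f g)
  then show ?case by (metis monomial_sum_mult)
qed

lemma real_polynomial_function_monomial: "real_polynomial_function (monomial m)"
  unfolding monomial_def
  by (intro real_polynomial_function_prod real_polynomial_function_power finite_Basis)
    (auto intro: bounded_linear_inner_left)

text \<open>For fixed \<open>z\<close> the homogeneity is a polynomial identity in the dilation
  factor \<open>2 ^ j\<close>. It holds for infinitely many factors, so coefficients agree and only
  monomials of weighted degree \<open>\<beta>\<close> remain. Positive weights bound their exponents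
  by \<open>\<beta>\<close>, leaving a finite family.\<close>

lemma quasihomogeneous_span:
  fixes D :: "int \<Rightarrow> 'a::euclidean_space \<Rightarrow> 'a"
  assumes D: "\<And>j z b. b \<in> Basis \<Longrightarrow> D j z \<bullet> b = 2 powi (j * int (w b)) * (z \<bullet> b)"
    and w: "\<And>b. b \<in> Basis \<Longrightarrow> w b > 0"
    and p: "real_polynomial_function p" "\<And>j z. p (D j z) = 2 powi (j * int \<beta>) * p z"
  shows "\<exists>c. \<forall>z. p z = (\<Sum>m\<in>Basis \<rightarrow>\<^sub>E {..\<beta>}. c m * monomial m z)"
proof -
  obtain L where L: "\<And>z. p z = monomial_sum L z"
    using real_polynomial_function_monomial_sum[OF p(1)] by blast
  define wt where "wt = (\<lambda>m. \<Sum>b\<in>Basis. w b * m b)"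
  have mono_D: "monomial m (D (int j) z) = (2 ^ j) ^ wt m * monomial m z" for m j z
  proof -
    have "monomial m (D (int j) z) = (\<Prod>b\<in>Basis. (2 ^ j) ^ (w b * m b) * (z \<bullet> b) ^ m b)"
      unfolding monomial_def
    proof (rule prod.cong)
      fix b :: 'a assume "b \<in> Basis"
      have "(2::real) powi (int j * int (w b)) = 2 ^ (j * w b)"
        by (metis of_nat_mult power_int_of_nat)
      then show "(D (int j) z \<bullet> b) ^ m b = (2 ^ j) ^ (w b * m b) * (z \<bullet> b) ^ m b"
        using D[OF \<open>b \<in> Basis\<close>] by (simp add: power_mult_distrib power_mult[symmetric] mult.assoc)
    qed simp
    also have "\<dots> = (2 ^ j) ^ wt m * monomial m z"
      by (simp add: prod.distrib power_sum[symmetric] wt_def monomial_def)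
    finally show ?thesis .
  qed
  define Lb where "Lb = filter (\<lambda>(a, m). wt m = \<beta>) L"
  have pLb: "p z = monomial_sum Lb z" for z
  proof -
    \<comment> \<open>\<open>Q L\<close> collects the terms at the fixed \<open>z\<close> by
      weighted degree, the indeterminate standing for the dilation factor.\<close>
    define Q where "Q = (\<lambda>L. \<Sum>(a, m)\<leftarrow>L. Polynomial.monom (a * monomial m z) (wt m))"
    have poly: "poly (Q L) (2 ^ j) = monomial_sum L (D (int j) z)" for L j
      by (induction L) (auto simp: Q_def poly_monom mono_D algebra_simps)
    have coeff: "coeff (Q L) \<beta> = monomial_sum (filter (\<lambda>(a, m). wt m = \<beta>) L) z" for L
      by (induction L) (auto simp: Q_def)
    define P where "P = Q L - Polynomial.monom (p z) \<beta>"
    have root: "poly P (2 ^ j) = 0" for j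
    proof -
      have "(2::real) powi (int j * int \<beta>) = (2 ^ j) ^ \<beta>"
        by (metis of_nat_mult power_int_of_nat power_mult)
      then show ?thesis
        using p(2)[of "int j" z] by (simp add: P_def poly poly_monom L[symmetric])
    qed
    have "inj (\<lambda>j. (2::real) ^ j)" by (auto simp: inj_def)
    then have "infinite (range (\<lambda>j. (2::real) ^ j))" using finite_imageD by blast
    moreover have "range (\<lambda>j. (2::real) ^ j) \<subseteq> {x. poly P x = 0}" using root by auto
    ultimately have "P = 0" using poly_roots_finite finite_subset by blast
    then have "coeff (Q L) \<beta> = p z" by (metis P_def coeff_monom right_minus_eq)
    then show ?thesis by (simp add: coeff Lb_def)
  qed
  have "\<exists>c. \<forall>z. monomial_sum L' z = (\<Sum>m\<in>Basis \<rightarrow>\<^sub>E {..\<beta>}. c m * monomial m z)"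
    if "\<forall>(a, m)\<in>set L'. wt m = \<beta>" for L'
    using that
  proof (induction L')
    case Nil
    show ?case by (intro exI[of _ "\<lambda>_. 0"]) simp
  next
    case (Cons x L')
    obtain a m where x: "x = (a, m)" by (cases x)
    obtain c where c: "\<And>z. monomial_sum L' z = (\<Sum>m\<in>Basis \<rightarrow>\<^sub>E {..\<beta>}. c m * monomial m z)"
      using Cons by auto
    \<comment> \<open>Elements of \<open>Basis \<rightarrow>\<^sub>E {..\<beta>}\<close> must be
      \<open>undefined\<close> outside \<open>Basis\<close>, while \<open>monomial\<close> only sees
      the exponents on \<open>Basis\<close>.\<close>
    define m' where "m' = restrict m Basis"
    have m: "monomial m z = monomial m' z" for z by (simp add: monomial_def m'_def)
    have "m b \<le> \<beta>" if "b \<in> Basis" for b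
    proof -
      have "m b \<le> w b * m b" using w[OF that] by simp
      also have "\<dots> \<le> wt m" unfolding wt_def using that by (intro member_le_sum) auto
      finally show ?thesis using Cons.prems x by simp
    qed
    then have m': "m' \<in> Basis \<rightarrow>\<^sub>E {..\<beta>}" by (auto simp: m'_def)
    have fin: "finite ((Basis :: 'a set) \<rightarrow>\<^sub>E {..\<beta>})" by (intro finite_PiE) auto
    have "monomial_sum (x # L') z = (\<Sum>m\<in>Basis \<rightarrow>\<^sub>E {..\<beta>}. (c m + (if m = m' then a else 0)) * monomial m z)" for z
      using m' fin by (simp add: x c m distrib_right sum.distrib if_distrib[of "\<lambda>t. t * _"] cong: if_cong)
    then show ?case by (intro exI[of _ "\<lambda>m. c m + (if m = m' then a else 0)"]) blast
  qed
  from this[of Lb] show ?thesis using pLb by (auto simp: Lb_def)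
qed

text \<open>The points depend only on the dilations and \<open>\<beta>\<close>: all such polynomials
  lie in the span of one finite family of monomials.\<close>

lemma quasihomogeneous_reproducing_points:
  fixes D :: "int \<Rightarrow> 'a::euclidean_space \<Rightarrow> 'a"
  assumes D: "\<And>j z b. b \<in> Basis \<Longrightarrow> D j z \<bullet> b = 2 powi (j * int (w b)) * (z \<bullet> b)"
    and w: "\<And>b. b \<in> Basis \<Longrightarrow> w b > 0"
  shows "\<exists>(N::nat) \<zeta> b. (\<forall>k<N. real_polynomial_function (b k)) \<and>
     (\<forall>p. real_polynomial_function p \<longrightarrow> (\<forall>j z. p (D j z) = 2 powi (j * int \<beta>) * p z) \<longrightarrow>
        (\<forall>z. p z = (\<Sum>k<N. p (\<zeta> k) * b k z)))"
proof -
  have fin: "finite ((Basis :: 'a set) \<rightarrow>\<^sub>E {..\<beta>})" by (intro finite_PiE) auto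
  obtain N \<zeta> b where *: "(\<forall>k<(N::nat). real_polynomial_function (b k)) \<and> (\<forall>c z. (\<Sum>m\<in>Basis \<rightarrow>\<^sub>E {..\<beta>}. c m * monomial m (z::'a))
        = (\<Sum>k<N. (\<Sum>m\<in>Basis \<rightarrow>\<^sub>E {..\<beta>}. c m * monomial m (\<zeta> k)) * b k z))"
    using ex_reproducing_points[OF fin, of monomial] real_polynomial_function_monomial by blast
  have "p z = (\<Sum>k<N. p (\<zeta> k) * b k z)"
    if p: "real_polynomial_function p" "\<forall>j z. p (D j z) = 2 powi (j * int \<beta>) * p z" for p z
  proof -
    obtain c where c: "\<And>z. p z = (\<Sum>m\<in>Basis \<rightarrow>\<^sub>E {..\<beta>}. c m * monomial m z)"
      using quasihomogeneous_span[of D w p \<beta>, OF D w p(1)] p(2) by blast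
    show ?thesis unfolding c using * by blast
  qed
  then show ?thesis using * by blast
qed

section \<open>Anisotropic dilations\<close>

lemma has_dir_deriv_compose_linear:
  assumes "has_dir_deriv e p q" "linear T" "T e = c *\<^sub>R e"
  shows "has_dir_deriv e (\<lambda>z. p (T z)) (\<lambda>z. c * q (T z))"
  unfolding has_dir_deriv_def
proof
  fix z
  have "((\<lambda>t. p (T z + t *\<^sub>R e)) has_real_derivative q (T z)) (at (c * 0))"
    using assms(1) by (simp add: has_dir_deriv_def)
  moreover have "((\<lambda>t. c * t) has_real_derivative c) (at 0)"
    by (auto intro!: derivative_eq_intros)
  ultimately have "((\<lambda>t. p (T z + (c * t) *\<^sub>R e)) has_real_derivative q (T z) * c) (at 0)"
    by (rule DERIV_chain2)
  then show "((\<lambda>t. p (T (z + t *\<^sub>R e))) has_real_derivative c * q (T z)) (at 0)"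
    using assms(2,3) by (simp add: linear_add linear_scale mult.commute)
qed

lemma mixed_hessian_compose_linear:
  fixes T :: "('m::finite, 'k::finite) pt \<Rightarrow> ('m, 'k) pt"
  assumes "real_polynomial_function \<phi>" "linear T"
    and "T (x_dir i) = c *\<^sub>R x_dir i" "T (y_dir j) = d *\<^sub>R y_dir j"
  shows "mixed_hessian (\<lambda>z. \<phi> (T z)) z $ i $ j = c * d * mixed_hessian \<phi> (T z) $ i $ j"
proof -
  obtain q h where q: "has_dir_deriv (y_dir j) \<phi> q" and h: "has_dir_deriv (x_dir i) q h"
    using real_polynomial_function_mixed_hessian[OF assms(1)] by metis
  have "mixed_hessian (\<lambda>z. \<phi> (T z)) z $ i $ j = d * (c * h (T z))"
    by (rule mixed_hessian_eq[OF has_dir_deriv_compose_linear[OF q assms(2,4)]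
          has_dir_deriv_cmult[OF has_dir_deriv_compose_linear[OF h assms(2,3)]]])
  then show ?thesis by (simp add: mixed_hessian_eq[OF q h])
qed

text \<open>One index type for all three groups of variables, so that an arbitrary nonzero
  coordinate of a point can be treated uniformly.\<close>

definition dir :: "'m + 'k + 'm \<Rightarrow> ('m::finite, 'k::finite) pt" where
  "dir v = (case v of Inl i \<Rightarrow> x_dir i | Inr (Inl k) \<Rightarrow> (0, axis k 1, 0) | Inr (Inr j) \<Rightarrow> y_dir j)"

definition crd :: "('m::finite, 'k::finite) pt \<Rightarrow> 'm + 'k + 'm \<Rightarrow> real" where
  "crd z v = z \<bullet> dir v"

definition wt :: "nat ^ 'm \<Rightarrow> nat ^ 'k \<Rightarrow> nat ^ 'm \<Rightarrow> 'm + 'k + 'm \<Rightarrow> nat" where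
  "wt \<alpha>' \<alpha>'' \<beta>' v = (case v of Inl i \<Rightarrow> \<alpha>' $ i | Inr (Inl k) \<Rightarrow> \<alpha>'' $ k | Inr (Inr j) \<Rightarrow> \<beta>' $ j)"

definition dil :: "nat ^ 'm \<Rightarrow> nat ^ 'k \<Rightarrow> nat ^ 'm \<Rightarrow> int \<Rightarrow> ('m::finite, 'k::finite) pt \<Rightarrow> ('m, 'k) pt" where
  "dil \<alpha>' \<alpha>'' \<beta>' j = (\<lambda>(x, u, y). (dilate j \<alpha>' x, dilate j \<alpha>'' u, dilate j \<beta>' y))"

lemma Basis_eq_dir: "Basis = range (dir :: _ \<Rightarrow> ('m::finite, 'k::finite) pt)"
proof -
  have "range (dir :: _ \<Rightarrow> ('m, 'k) pt) = range x_dir \<union> range (\<lambda>k. (0, axis k 1, 0)) \<union> range y_dir"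
    by (simp add: UNIV_sum image_Un image_image dir_def Un_assoc)
  then show ?thesis
    by (simp add: Basis_prod_def Basis_vec_def image_Un image_image zero_prod_def
        UNION_singleton_eq_range x_dir_def y_dir_def Un_assoc)
qed

lemma dir_in_Basis [simp]: "dir v \<in> Basis" by (simp add: Basis_eq_dir)

lemma inj_dir: "inj dir"
  by (auto simp: inj_def dir_def x_dir_def y_dir_def axis_eq_axis split: sum.splits)

lemma crd_dir: "crd (dir v) v' = (if v = v' then 1 else 0)"
  by (auto simp: crd_def inner_Basis dest: injD[OF inj_dir])

lemma crd_dil: "crd (dil \<alpha>' \<alpha>'' \<beta>' j z) v = 2 powi (j * int (wt \<alpha>' \<alpha>'' \<beta>' v)) * crd z v"
  by (cases z)
    (auto simp: crd_def dir_def x_dir_def y_dir_def dil_def wt_def dilate_def inner_axis split: sum.splits)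

lemma pt_eqI: "(\<And>v. crd z v = crd z' v) \<Longrightarrow> z = z'"
  unfolding crd_def by (rule euclidean_eqI) (auto simp: Basis_eq_dir)

lemma crd_add [simp]: "crd (z + z') v = crd z v + crd z' v"
  and crd_scaleR [simp]: "crd (a *\<^sub>R z) v = a * crd z v"
  and crd_zero [simp]: "crd 0 v = 0"
  by (simp_all add: crd_def inner_add_left)

lemma linear_dil: "linear (dil \<alpha>' \<alpha>'' \<beta>' j)"
  by (rule linearI; rule pt_eqI) (simp_all add: crd_dil algebra_simps)

lemma dil_dir: "dil \<alpha>' \<alpha>'' \<beta>' j (dir v) = 2 powi (j * int (wt \<alpha>' \<alpha>'' \<beta>' v)) *\<^sub>R dir v"
  by (rule pt_eqI) (auto simp: crd_dil crd_dir)

lemma x_dir_eq: "x_dir i = dir (Inl i)" and y_dir_eq: "y_dir j = dir (Inr (Inr j))"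
  by (simp_all add: dir_def)

lemma norm_le_crd:
  assumes "\<And>v. \<bar>crd z v\<bar> \<le> \<bar>crd z' v\<bar>" shows "norm z \<le> norm z'"
  by (rule norm_le_componentwise) (use assms in \<open>auto simp: crd_def Basis_eq_dir\<close>)

lemma Lambda_iff:
  "p \<in> Lambda \<alpha>' \<alpha>'' \<beta>' \<beta>'' \<longleftrightarrow> (\<forall>l. real_polynomial_function (\<lambda>z. p z $ l) \<and>
     (\<forall>j z. p (dil \<alpha>' \<alpha>'' \<beta>' j z) $ l = 2 powi (j * int (\<beta>'' $ l)) * p z $ l))"
  by (simp add: Lambda_def dil_def)

text \<open>The norm along a dilation orbit tends to 0 and to infinity, and a single step multiplies
  it by at most \<open>2 ^ W\<close>, with \<open>W\<close> the sum of the weights. At the first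
  step reaching norm 1 it is therefore at most \<open>2 ^ W\<close>, a bound independent of
  \<open>z\<close>.\<close>

lemma ex_dil_annulus:
  assumes w: "\<And>v. wt \<alpha>' \<alpha>'' \<beta>' v > 0"
  obtains R where "\<And>z. z \<noteq> 0 \<Longrightarrow> \<exists>j. dil \<alpha>' \<alpha>'' \<beta>' j z \<in> cball 0 R - ball 0 1"
proof
  fix z :: "('a, 'b) pt" assume "z \<noteq> 0"
  define f where "f j = norm (dil \<alpha>' \<alpha>'' \<beta>' j z)" for j
  define W where "W = (\<Sum>v\<in>UNIV. wt \<alpha>' \<alpha>'' \<beta>' v)"
  have W: "wt \<alpha>' \<alpha>'' \<beta>' v \<le> W" for v
    unfolding W_def by (rule member_le_sum) auto
  have f0: "f 0 = norm z" 
    unfolding f_def by (rule arg_cong[where f=norm], rule pt_eqI) (simp add: crd_dil)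
  have grow: "2 ^ n * norm z \<le> f (int n)" for n
  proof -
    have "norm ((2 ^ n :: real) *\<^sub>R z) \<le> f (int n)"
      unfolding f_def
    proof (rule norm_le_crd)
      fix v
      have "(2::real) ^ n \<le> 2 ^ (n * wt \<alpha>' \<alpha>'' \<beta>' v)"
        using w[of v] by (intro power_increasing) auto
      also have "\<dots> = 2 powi (int n * int (wt \<alpha>' \<alpha>'' \<beta>' v))"
        by (metis of_nat_mult power_int_of_nat)
      finally show "\<bar>crd ((2 ^ n :: real) *\<^sub>R z) v\<bar> \<le> \<bar>crd (dil \<alpha>' \<alpha>'' \<beta>' (int n) z) v\<bar>"
        by (simp add: crd_dil abs_mult mult_right_mono)
    qed
    then show ?thesis by simp
  qed
  have shrink: "f (- int n) \<le> norm z / 2 ^ n" for n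
  proof -
    have "f (- int n) \<le> norm (inverse (2 ^ n :: real) *\<^sub>R z)"
      unfolding f_def
    proof (rule norm_le_crd)
      fix v
      have "2 powi (- int n * int (wt \<alpha>' \<alpha>'' \<beta>' v)) = inverse ((2::real) ^ (n * wt \<alpha>' \<alpha>'' \<beta>' v))"
        by (metis mult_minus_left of_nat_mult power_int_minus power_int_of_nat)
      also have "\<dots> \<le> inverse (2 ^ n)"
        using w[of v] by (intro le_imp_inverse_le power_increasing) auto
      finally show "\<bar>crd (dil \<alpha>' \<alpha>'' \<beta>' (- int n) z) v\<bar> \<le> \<bar>crd (inverse (2 ^ n :: real) *\<^sub>R z) v\<bar>"
        by (simp add: crd_dil abs_mult mult_right_mono)
    qed
    then show ?thesis by (simp add: divide_inverse mult.commute)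
  qed
  have step: "f (j + 1) \<le> 2 ^ W * f j" for j
  proof -
    have "f (j + 1) \<le> norm ((2 ^ W :: real) *\<^sub>R dil \<alpha>' \<alpha>'' \<beta>' j z)"
      unfolding f_def
    proof (rule norm_le_crd)
      fix v
      have "2 powi ((j + 1) * int (wt \<alpha>' \<alpha>'' \<beta>' v))
          = 2 powi (j * int (wt \<alpha>' \<alpha>'' \<beta>' v)) * (2::real) ^ wt \<alpha>' \<alpha>'' \<beta>' v"
        by (simp add: distrib_right power_int_add)
      also have "\<dots> \<le> 2 powi (j * int (wt \<alpha>' \<alpha>'' \<beta>' v)) * 2 ^ W"
        using W[of v] by (intro mult_left_mono power_increasing) auto
      finally show "\<bar>crd (dil \<alpha>' \<alpha>'' \<beta>' (j + 1) z) v\<bar> \<le> \<bar>crd ((2 ^ W :: real) *\<^sub>R dil \<alpha>' \<alpha>'' \<beta>' j z) v\<bar>"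
        by (simp add: crd_dil abs_mult mult_right_mono mult.assoc[symmetric] mult.commute[of "2 ^ W"])
    qed
    then show ?thesis by (simp add: f_def)
  qed
  obtain n0 where n0: "norm z < 2 ^ n0"
    using real_arch_pow[of 2 "norm z"] by auto
  then have lo: "f (- int n0) < 1"
    using shrink[of n0] by (simp add: order_le_less_trans divide_less_eq)
  obtain n1 where n1: "1 / norm z < 2 ^ n1"
    using real_arch_pow[of 2 "1 / norm z"] by auto
  have "1 \<le> f (int n1)"
    using grow[of n1] n1 \<open>z \<noteq> 0\<close> by (simp add: divide_less_eq)
  \<comment> \<open>The search starts at exponent \<open>- n0\<close>, where the norm is below 1, so
    that the first exponent sought is indexed by a natural number that has a predecessor.\<close>
  then have "1 \<le> f (- int n0 + int (n0 + n1))" by simp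
  then obtain n where n: "1 \<le> f (- int n0 + int n)" "\<And>m. m < n \<Longrightarrow> \<not> 1 \<le> f (- int n0 + int m)"
    using exists_least_iff[of "\<lambda>n. 1 \<le> f (- int n0 + int n)"] by blast
  have "n \<noteq> 0" using n(1) lo by (intro notI) simp
  then obtain m where m: "n = Suc m" using not0_implies_Suc by blast
  have "f (- int n0 + int n) \<le> 2 ^ W * f (- int n0 + int m)"
    using step[of "- int n0 + int m"] by (simp add: m algebra_simps)
  also have "\<dots> \<le> 2 ^ W * 1"
    using n(2)[of m] m by (intro mult_left_mono) auto
  finally have "dil \<alpha>' \<alpha>'' \<beta>' (- int n0 + int n) z \<in> cball 0 (2 ^ W) - ball 0 1"
    using n(1) by (simp add: f_def)
  then show "\<exists>j. dil \<alpha>' \<alpha>'' \<beta>' j z \<in> cball 0 (2 ^ (\<Sum>v\<in>UNIV. wt \<alpha>' \<alpha>'' \<beta>' v)) - ball 0 1"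
    unfolding W_def by blast
qed

section \<open>Reduction to a compact set and openness of the rank condition\<close>

abbreviation hess :: "(('m::finite, 'k::finite) pt \<Rightarrow> real ^ 'k) \<Rightarrow> ('m, 'k) pt \<Rightarrow> real ^ 'k \<Rightarrow> real ^ 'm ^ 'm"
  where "hess p z \<eta> \<equiv> mixed_hessian (\<lambda>w. \<Sum>l\<in>UNIV. \<eta> $ l * p w $ l) z"

text \<open>Dilation multiplies the \<open>l\<close>-th component by \<open>C l\<close>, which is
  absorbed into \<open>\<eta>\<close>, and the Hessian entries by row and column factors. Hence the
  Hessian at the dilated point and a unit covector is a rescaling of the one at \<open>z\<close>,
  and its rank is no larger.\<close>

lemma rank_condition_on_annulus:
  assumes p: "p \<in> Lambda \<alpha>' \<alpha>'' \<beta>' \<beta>''"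
    and R: "\<And>z. z \<noteq> 0 \<Longrightarrow> \<exists>j. dil \<alpha>' \<alpha>'' \<beta>' j z \<in> cball 0 R - ball 0 1"
    and r: "\<And>z \<eta>. z \<in> cball 0 R - ball 0 1 \<Longrightarrow> \<eta> \<in> sphere 0 1 \<Longrightarrow> r \<le> rank (hess p z \<eta>)"
  shows "rank_condition r p"
  unfolding rank_condition_def
proof (intro allI impI)
  fix z :: "('a, 'b) pt" and \<eta> :: "real ^ 'b" assume "z \<noteq> 0" "\<eta> \<noteq> 0"
  obtain j where j: "dil \<alpha>' \<alpha>'' \<beta>' j z \<in> cball 0 R - ball 0 1" using R[OF \<open>z \<noteq> 0\<close>] by blast
  define T where "T = dil \<alpha>' \<alpha>'' \<beta>' j"
  define C where "C l = (2::real) powi (j * int (\<beta>'' $ l))" for l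
  have C: "C l \<noteq> 0" for l by (simp add: C_def)
  define \<eta>1 :: "real ^ 'b" where "\<eta>1 = (\<chi> l. \<eta> $ l / C l)"
  have "\<eta>1 \<noteq> 0" using \<open>\<eta> \<noteq> 0\<close> C by (auto simp: \<eta>1_def vec_eq_iff)
  define s where "s = norm \<eta>1"
  have s: "s \<noteq> 0" using \<open>\<eta>1 \<noteq> 0\<close> by (simp add: s_def)
  define \<eta>2 where "\<eta>2 = (1 / s) *\<^sub>R \<eta>1"
  have "\<eta>2 \<in> sphere 0 1" using s by (simp add: \<eta>2_def s_def)
  define c where "c i = (2::real) powi (j * int (wt \<alpha>' \<alpha>'' \<beta>' (Inl i)))" for i :: 'a
  define d where "d i = (2::real) powi (j * int (wt \<alpha>' \<alpha>'' \<beta>' (Inr (Inr i))))" for i :: 'a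
  have cd: "c i \<noteq> 0" "d i \<noteq> 0" for i by (simp_all add: c_def d_def)
  have poly: "real_polynomial_function (\<lambda>w. p w $ l)" for l using p by (simp add: Lambda_iff)
  have poly_sum: "real_polynomial_function (\<lambda>w. \<Sum>l\<in>UNIV. \<xi> $ l * p w $ l)" for \<xi> :: "real ^ 'b"
    by (intro real_polynomial_function_sum real_polynomial_function.intros(4)[OF real_polynomial_function.intros(2) poly]) simp
  \<comment> \<open>The sum over \<open>{()}\<close> puts the constant factor \<open>1 / s\<close>
    into the form required by \<open>mixed_hessian_sum\<close>.\<close>
  have "(\<lambda>w. \<Sum>l\<in>UNIV. \<eta>2 $ l * p (T w) $ l) = (\<lambda>w. \<Sum>a\<in>{()}. (1 / s) * (\<Sum>l\<in>UNIV. \<eta> $ l * p w $ l))"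
    using p C by (auto simp: Lambda_iff T_def \<eta>2_def \<eta>1_def C_def[symmetric] sum_distrib_left)
  then have A: "mixed_hessian (\<lambda>w. \<Sum>l\<in>UNIV. \<eta>2 $ l * p (T w) $ l) z $ i $ k = (1 / s) * hess p z \<eta> $ i $ k" for i k
    using mixed_hessian_sum[of "{()}" "\<lambda>_ w. \<Sum>l\<in>UNIV. \<eta> $ l * p w $ l" "\<lambda>_. 1 / s"] poly_sum by simp
  have B: "mixed_hessian (\<lambda>w. \<Sum>l\<in>UNIV. \<eta>2 $ l * p (T w) $ l) z $ i $ k
      = c i * d k * hess p (T z) \<eta>2 $ i $ k" for i k
    by (rule mixed_hessian_compose_linear[OF poly_sum])
      (simp_all add: T_def linear_dil x_dir_eq y_dir_eq dil_dir c_def d_def)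
  have "c i * d k * hess p (T z) \<eta>2 $ i $ k = (1 / s) * hess p z \<eta> $ i $ k" for i k
    by (rule trans[OF sym[OF B] A])
  then have "hess p (T z) \<eta>2 $ i $ k = (1 / s / c i) * hess p z \<eta> $ i $ k * (1 / d k)" for i k
    using cd(1)[of i] cd(2)[of k] s by (simp add: field_simps)
  then have "hess p (T z) \<eta>2 = (\<chi> i k. (1 / s / c i) * hess p z \<eta> $ i $ k * (1 / d k))"
    by (simp add: vec_eq_iff)
  then have "rank (hess p (T z) \<eta>2) \<le> rank (hess p z \<eta>)"
    by (simp only: rank_rescale_le)
  then show "r \<le> rank (hess p z \<eta>)"
    using r[OF j \<open>\<eta>2 \<in> sphere 0 1\<close>] by (simp add: T_def)
qed

lemma real_polynomial_function_continuous_on: "real_polynomial_function p \<Longrightarrow> continuous_on S p"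
  by (meson continuous_at_imp_continuous_on continuous_real_polymonial_function)

lemma continuous_on_cart:
  fixes f :: "'a::topological_space \<Rightarrow> 'b::topological_space ^ 'n"
  assumes "\<And>i. continuous_on S (\<lambda>x. f x $ i)" shows "continuous_on S f"
  using continuous_on_vec_lambda[of S "\<lambda>i x. f x $ i"] assms by simp

text \<open>The complement is the projection of a closed set along the compact \<open>K\<close>, and
  such projections are closed maps.\<close>

lemma open_compact_forall:
  fixes F :: "'s::topological_space \<Rightarrow> 'p::topological_space \<Rightarrow> 'b::topological_space"
  assumes "compact K" "continuous_on UNIV (\<lambda>(s, p). F s p)" "open G"
  shows "open {p. \<forall>s\<in>K. F s p \<in> G}"
proof -
  have "closed_map (prod_topology (top_of_set K) (euclidean :: 'p topology)) euclidean snd"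
    by (rule closed_map_snd) (simp add: compact_space_subtopology assms(1))
  moreover have "closed ((\<lambda>(s, p). F s p) -` (- G))"
    using assms(2,3) by (intro closed_vimage) auto
  then have "closedin (prod_topology (top_of_set K) euclidean) (((\<lambda>(s, p). F s p) -` (- G)) \<inter> (K \<times> UNIV))"
    using closedin_closed_Int[of "(\<lambda>(s, p). F s p) -` (- G)" "K \<times> UNIV"]
    by (simp add: prod_topology_euclidean[symmetric] subtopology_Times Int_commute del: prod_topology_euclidean)
  ultimately have "closed (snd ` (((\<lambda>(s, p). F s p) -` (- G)) \<inter> (K \<times> UNIV)))"
    by (simp add: closed_map_def)
  moreover have "{p. \<forall>s\<in>K. F s p \<in> G} = - snd ` (((\<lambda>(s, p). F s p) -` (- G)) \<inter> (K \<times> UNIV))"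
    by force
  ultimately show ?thesis by (simp add: open_closed)
qed

text \<open>On \<open>Lambda\<close> the Hessian is determined by finitely many values of
  \<open>p\<close>, and it suffices to test \<open>z\<close> in an annulus and unit covectors.
  Openness of the rank bound and compactness of this test set give the claim.\<close>

lemma openin_rank_condition:
  fixes \<alpha>' \<beta>' :: "nat ^ 'm::finite" and \<alpha>'' \<beta>'' :: "nat ^ 'k::finite"
  assumes w: "\<And>v. wt \<alpha>' \<alpha>'' \<beta>' v > 0"
  shows "openin (top_of_set (Lambda \<alpha>' \<alpha>'' \<beta>' \<beta>'')) {p \<in> Lambda \<alpha>' \<alpha>'' \<beta>' \<beta>''. rank_condition r p}"
proof -
  obtain R where R: "\<And>z :: ('m, 'k) pt. z \<noteq> 0 \<Longrightarrow> \<exists>j. dil \<alpha>' \<alpha>'' \<beta>' j z \<in> cball 0 R - ball 0 1"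
    using ex_dil_annulus[OF w] by blast
  define K where "K = ((cball 0 R - ball 0 1) :: ('m, 'k) pt set) \<times> (sphere 0 1 :: (real ^ 'k) set)"
  have "compact K"
    unfolding K_def by (intro compact_Times compact_diff compact_cball open_ball compact_sphere)
  define W where "W b = wt \<alpha>' \<alpha>'' \<beta>' (inv dir b)" for b :: "('m, 'k) pt"
  have W: "dil \<alpha>' \<alpha>'' \<beta>' j z \<bullet> b = 2 powi (j * int (W b)) * (z \<bullet> b)" "W b > 0" if "b \<in> Basis" for j z b
  proof -
    obtain v where b: "b = dir v" using \<open>b \<in> Basis\<close> by (auto simp: Basis_eq_dir)
    show "dil \<alpha>' \<alpha>'' \<beta>' j z \<bullet> b = 2 powi (j * int (W b)) * (z \<bullet> b)" "W b > 0"
      using crd_dil[of \<alpha>' \<alpha>'' \<beta>' j z v] w by (simp_all add: b W_def inv_f_f[OF inj_dir] crd_def)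
  qed
  define Q where "Q l N \<zeta> b \<longleftrightarrow> (\<forall>k<(N::nat). real_polynomial_function (b k)) \<and>
     (\<forall>p. real_polynomial_function p \<longrightarrow> (\<forall>j z. p (dil \<alpha>' \<alpha>'' \<beta>' j z) = 2 powi (j * int (\<beta>'' $ l)) * p z) \<longrightarrow>
        (\<forall>z. p z = (\<Sum>k<N. p (\<zeta> k) * b k z)))" for l N \<zeta> b
  have "\<forall>l. \<exists>N \<zeta> b. Q l N \<zeta> b"
    unfolding Q_def by (intro allI quasihomogeneous_reproducing_points[of "dil \<alpha>' \<alpha>'' \<beta>'" W] W)
  then obtain N \<zeta> b where Q: "\<And>l. Q l (N l) (\<zeta> l) (b l)" by metis
  have b: "real_polynomial_function (b l k)" if "k < N l" for l k
    using Q[of l] that unfolding Q_def by blast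
  have rep: "p z = (\<Sum>k<N l. p (\<zeta> l k) * b l k z)"
    if "real_polynomial_function p" "\<forall>j z. p (dil \<alpha>' \<alpha>'' \<beta>' j z) = 2 powi (j * int (\<beta>'' $ l)) * p z" for l p z
    using Q[of l] that unfolding Q_def by blast
  \<comment> \<open>\<open>F\<close> is the Hessian rewritten through the reproducing points. It
    makes sense for every function \<open>p\<close>, is jointly continuous for pointwise
    convergence, and agrees with \<open>hess\<close> on \<open>Lambda\<close>.\<close>
  define F :: "('m, 'k) pt \<times> (real ^ 'k) \<Rightarrow> (('m, 'k) pt \<Rightarrow> real ^ 'k) \<Rightarrow> real ^ 'm ^ 'm" where
    "F = (\<lambda>(z, \<eta>) p. \<chi> i j. \<Sum>l\<in>UNIV. \<eta> $ l * (\<Sum>k<N l. p (\<zeta> l k) $ l * mixed_hessian (b l k) z $ i $ j))"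
  have F: "hess p z \<eta> = F (z, \<eta>) p" if p: "p \<in> Lambda \<alpha>' \<alpha>'' \<beta>' \<beta>''" for p z \<eta>
  proof -
    have poly: "real_polynomial_function (\<lambda>w. p w $ l)" for l using p by (simp add: Lambda_iff)
    have eq: "(\<lambda>w. p w $ l) = (\<lambda>w. \<Sum>k<N l. p (\<zeta> l k) $ l * b l k w)" for l
      by (rule ext, rule rep[OF poly]) (use p in \<open>simp add: Lambda_iff\<close>)
    have "mixed_hessian (\<lambda>w. p w $ l) z $ i $ j
        = (\<Sum>k<N l. p (\<zeta> l k) $ l * mixed_hessian (b l k) z $ i $ j)" for l i j
      by (subst eq[of l], rule mixed_hessian_sum) (simp add: b)
    then have "hess p z \<eta> $ i $ j = F (z, \<eta>) p $ i $ j" for i j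
      by (simp only: F_def mixed_hessian_sum[OF poly] case_prod_conv vec_lambda_beta)
    then show ?thesis unfolding vec_eq_iff by blast
  qed
  have comp: "continuous_on UNIV (\<lambda>q :: (('m, 'k) pt \<times> (real ^ 'k)) \<times> (('m, 'k) pt \<Rightarrow> real ^ 'k). f (fst (fst q)))"
    if "continuous_on UNIV f" for f :: "('m, 'k) pt \<Rightarrow> real"
    by (rule continuous_on_compose2[OF that]) (auto intro!: continuous_intros)
  have eval: "continuous_on UNIV (\<lambda>q :: (('m, 'k) pt \<times> (real ^ 'k)) \<times> (('m, 'k) pt \<Rightarrow> real ^ 'k). snd q x)" for x
    by (rule continuous_on_compose2[OF continuous_on_product_coordinates continuous_on_snd[OF continuous_on_id]]) simp
  have "continuous_on UNIV (\<lambda>(s, p). F s p)"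
    unfolding F_def case_prod_beta
    by (intro continuous_on_cart, simp only: vec_lambda_beta)
      (intro continuous_on_sum continuous_on_mult continuous_on_component comp[OF real_polynomial_function_continuous_on]
        real_polynomial_function_mixed_hessian_entry b continuous_on_component[OF eval] continuous_intros; simp)
  then have "open {p. \<forall>s\<in>K. F s p \<in> {A. r \<le> rank A}}"
    by (rule open_compact_forall[OF \<open>compact K\<close> _ open_rank_ge])
  moreover have "{p \<in> Lambda \<alpha>' \<alpha>'' \<beta>' \<beta>''. rank_condition r p}
      = Lambda \<alpha>' \<alpha>'' \<beta>' \<beta>'' \<inter> {p. \<forall>s\<in>K. F s p \<in> {A. r \<le> rank A}}"
  proof (intro equalityI subsetI)
    fix p assume p: "p \<in> {p \<in> Lambda \<alpha>' \<alpha>'' \<beta>' \<beta>''. rank_condition r p}"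
    have "r \<le> rank (F s p)" if "s \<in> K" for s
    proof -
      obtain z \<eta> where s: "s = (z, \<eta>)" "z \<in> cball 0 R - ball 0 1" "\<eta> \<in> sphere 0 1"
        using \<open>s \<in> K\<close> by (auto simp: K_def)
      then have "z \<noteq> 0" "\<eta> \<noteq> 0" by auto
      then have "r \<le> rank (hess p z \<eta>)" using p unfolding rank_condition_def by blast
      moreover have "hess p z \<eta> = F s p" using p F s(1) by blast
      ultimately show ?thesis by (simp only:)
    qed
    then show "p \<in> Lambda \<alpha>' \<alpha>'' \<beta>' \<beta>'' \<inter> {p. \<forall>s\<in>K. F s p \<in> {A. r \<le> rank A}}" using p by auto
  next
    fix p assume p: "p \<in> Lambda \<alpha>' \<alpha>'' \<beta>' \<beta>'' \<inter> {p. \<forall>s\<in>K. F s p \<in> {A. r \<le> rank A}}"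
    then have L: "p \<in> Lambda \<alpha>' \<alpha>'' \<beta>' \<beta>''" and K: "\<And>s. s \<in> K \<Longrightarrow> r \<le> rank (F s p)" by auto
    have "rank_condition r p"
    proof (rule rank_condition_on_annulus[OF L R])
      show "r \<le> rank (hess p z \<eta>)" if "z \<in> cball 0 R - ball 0 1" "\<eta> \<in> sphere 0 1" for z \<eta>
        unfolding F[OF L] by (rule K) (use that in \<open>simp add: K_def\<close>)
    qed
    then show "p \<in> {p \<in> Lambda \<alpha>' \<alpha>'' \<beta>' \<beta>''. rank_condition r p}" using p by auto
  qed
  ultimately show ?thesis by (simp add: openin_open_Int)
qed

section \<open>Perturbation by monomials\<close>

definition pert_monomial :: "'m \<Rightarrow> 'm \<Rightarrow> 'm + 'k + 'm \<Rightarrow> nat \<Rightarrow> ('m::finite, 'k::finite) pt \<Rightarrow> real" where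
  "pert_monomial i j v n z = crd z (Inl i) * crd z (Inr (Inr j)) * crd z v ^ n"

lemma bounded_linear_crd: "bounded_linear (\<lambda>z. crd z v)"
  by (auto simp: crd_def intro: bounded_linear_inner_left)

lemma real_polynomial_function_pert_monomial: "real_polynomial_function (pert_monomial i j v n)"
  unfolding pert_monomial_def
  by (intro real_polynomial_function.intros(4) real_polynomial_function_power
      real_polynomial_function.intros(1) bounded_linear_crd)

lemma has_dir_deriv_crd: "has_dir_deriv (dir v) (\<lambda>z. crd z v') (\<lambda>z. if v = v' then 1 else 0)"
  using has_dir_deriv_linear[OF bounded_linear.linear[OF bounded_linear_crd], of "dir v" v']
  by (simp add: crd_dir)

text \<open>The product rule leaves no term in which both derivatives fall on the power, since
  \<open>v\<close> cannot be an \<open>x'\<close>- and a \<open>y'\<close>-variable at once.\<close>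

lemma mixed_hessian_pert_monomial:
  "mixed_hessian (pert_monomial i' j' v n) z $ i $ j =
     (if i = i' \<and> j = j' then crd z v ^ n else 0)
     + (if i = i' \<and> Inr (Inr j) = v then crd z (Inr (Inr j')) * (real n * crd z v ^ (n - 1)) else 0)
     + (if j = j' \<and> Inl i = v then crd z (Inl i') * (real n * crd z v ^ (n - 1)) else 0)"
proof -
  let ?X = "\<lambda>z. crd z (Inl i')" and ?Y = "\<lambda>z. crd z (Inr (Inr j'))" and ?V = "\<lambda>z. crd z v ^ n"
  let ?dV = "\<lambda>u z. real n * crd z v ^ (n - 1) * (if u = v then 1 else 0)"
  let ?ddV = "\<lambda>z. (real n * (real (n - 1) * crd z v ^ (n - 1 - 1) * (if Inl i = v then 1 else 0)))
      * (if Inr (Inr j) = v then 1 else 0) + real n * crd z v ^ (n - 1) * 0"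
  have V: "has_dir_deriv (dir u) ?V (?dV u)" for u
    by (rule has_dir_deriv_power[OF has_dir_deriv_crd])
  have dV: "has_dir_deriv (dir (Inl i)) (?dV (Inr (Inr j))) ?ddV"
    by (intro has_dir_deriv_mult has_dir_deriv_cmult has_dir_deriv_power has_dir_deriv_crd has_dir_deriv_const)
  have X: "has_dir_deriv (dir u) ?X (\<lambda>z. if u = Inl i' then 1 else 0)"
    and Y: "has_dir_deriv (dir u) ?Y (\<lambda>z. if u = Inr (Inr j') then 1 else 0)" for u
    by (rule has_dir_deriv_crd)+
  have c: "has_dir_deriv (dir u) (\<lambda>z. if b then 1 else 0) (\<lambda>z. 0)" for u b
    by (rule has_dir_deriv_const)
  note first = has_dir_deriv_mult[OF has_dir_deriv_mult[OF X Y] V, of "Inr (Inr j)"]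
  note second = has_dir_deriv_add[OF
      has_dir_deriv_mult[OF has_dir_deriv_add[OF has_dir_deriv_mult[OF c Y] has_dir_deriv_mult[OF X c]] V]
      has_dir_deriv_mult[OF has_dir_deriv_mult[OF X Y] dV]]
  show ?thesis
    using mixed_hessian_eq[OF first[folded y_dir_eq] second[folded x_dir_eq], of z]
    by (auto simp: pert_monomial_def[abs_def] mult.assoc)
qed

text \<open>If \<open>v\<close> is itself the \<open>i\<close>-th \<open>x'\<close>- or the
  \<open>j\<close>-th \<open>y'\<close>-variable, the extra term raises the coefficient from 1 to
  \<open>1 + n\<close>, so there is no cancellation.\<close>

lemma mixed_hessian_pert_monomial_diag:
  assumes "crd z v \<noteq> 0"
  shows "mixed_hessian (pert_monomial i j v n) z $ i $ j \<noteq> 0"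
proof -
  have *: "crd z v ^ n + crd z v * (real n * crd z v ^ (n - 1)) = (1 + real n) * crd z v ^ n"
    by (cases n) (auto simp: algebra_simps)
  have "(1 + real n) * crd z v ^ n \<noteq> 0" using assms by (simp add: add_pos_nonneg less_imp_neq[symmetric])
  then show ?thesis using assms * by (auto simp: mixed_hessian_pert_monomial)
qed

text \<open>
  The monomial \<open>x'\<^sub>i y'\<^sub>j v\<^sup>n\<close> contributes to a Hessian entry other than \<open>(i, j)\<close> only if \<open>v\<close> is the \<open>x'\<close>- or
  the \<open>y'\<close>-variable of that entry, so the system is triangular once the entries involving \<open>v\<close>
  are put last.
\<close>
lemma pert_monomial_triangular:
  fixes z :: "('m::finite, 'k::finite) pt"
  assumes "crd z v \<noteq> 0"
    and eq: "\<And>i j. (i, j) \<in> P \<Longrightarrow>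
      (\<Sum>e\<in>P. mixed_hessian (pert_monomial (fst e) (snd e) v (n e)) z $ i $ j * y e) = 0"
    and "e \<in> P"
  shows "y e = (0 :: real)"
proof -
  let ?\<Phi> = "\<lambda>e e'. mixed_hessian (pert_monomial (fst e') (snd e') v (n e')) z $ fst e $ snd e"
  define special where "special e \<longleftrightarrow> v = Inl (fst e) \<or> v = Inr (Inr (snd e))" for e :: "'m \<times> 'm"
  \<comment> \<open>Row \<open>e\<close> is a Hessian entry and column \<open>e'\<close> a monomial;
    off the diagonal only special rows meet nonspecial columns.\<close>
  have off: "special e \<and> \<not> special e'" if "e \<noteq> e'" "?\<Phi> e e' \<noteq> 0" for e e'
    using that by (auto simp: mixed_hessian_pert_monomial special_def prod_eq_iff split: if_splits)
  have diag: "y e = 0" if "e \<in> P" "\<And>e'. e' \<in> P \<Longrightarrow> e' \<noteq> e \<Longrightarrow> ?\<Phi> e e' * y e' = 0" for e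
  proof -
    have "0 = (\<Sum>e'\<in>P. ?\<Phi> e e' * y e')" using eq[of "fst e" "snd e"] \<open>e \<in> P\<close> by simp
    also have "\<dots> = ?\<Phi> e e * y e + (\<Sum>e'\<in>P - {e}. ?\<Phi> e e' * y e')"
      using that(1) by (intro sum.remove) auto
    also have "(\<Sum>e'\<in>P - {e}. ?\<Phi> e e' * y e') = 0"
      using that(2) by (intro sum.neutral) blast
    finally show ?thesis
      using mixed_hessian_pert_monomial_diag[OF assms(1), of "fst e" "snd e" "n e"] by simp
  qed
  \<comment> \<open>Rows that are not special are diagonal; once their unknowns vanish, the special
    rows are diagonal as well.\<close>
  have nonspecial: "y e = 0" if "e \<in> P" "\<not> special e" for e
    by (rule diag[OF that(1)]) (metis off that(2) mult_zero_left)
  show ?thesis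
    by (rule diag[OF \<open>e \<in> P\<close>]) (metis off nonspecial mult_eq_0_iff)
qed

section \<open>The family of perturbations and its parameters\<close>

type_synonym ('m, 'k) pert_index = "'k \<times> ('m \<times> 'm) \<times> ('m + 'k + 'm)"

text \<open>There is a parameter for every component, position and variable, because the coordinate
  that is nonzero varies with the point. Positions outside \<open>P\<close> get the term 0, which
  keeps the parameter space a full \<open>real ^ ('m, 'k) pert_index\<close>.\<close>

definition pert_term ::
  "('m \<times> 'm) set \<Rightarrow> (('m, 'k) pert_index \<Rightarrow> nat) \<Rightarrow> ('m, 'k) pert_index \<Rightarrow> ('m::finite, 'k::finite) pt \<Rightarrow> real"
  where "pert_term P n e z =
    (if fst (snd e) \<in> P then pert_monomial (fst (fst (snd e))) (snd (fst (snd e))) (snd (snd e)) (n e) z else 0)"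

definition pert ::
  "('m \<times> 'm) set \<Rightarrow> (('m, 'k) pert_index \<Rightarrow> nat) \<Rightarrow> (('m, 'k) pt \<Rightarrow> real ^ 'k) \<Rightarrow>
    real ^ ('m, 'k) pert_index \<Rightarrow> ('m::finite, 'k::finite) pt \<Rightarrow> real ^ 'k"
  where "pert P n p c z = (\<chi> l. p z $ l + (\<Sum>e\<in>UNIV. (if fst e = l then c $ e else 0) * pert_term P n e z))"

lemma real_polynomial_function_pert_term: "real_polynomial_function (pert_term P n e)"
  by (cases "fst (snd e) \<in> P")
    (simp_all add: pert_term_def[abs_def] real_polynomial_function_pert_monomial[unfolded pert_monomial_def[abs_def]]
      pert_monomial_def real_polynomial_function.intros(2))

lemma real_polynomial_function_pert:
  assumes "real_polynomial_function (\<lambda>z. p z $ l)"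
  shows "real_polynomial_function (\<lambda>z. pert P n p c z $ l)"
  unfolding pert_def vec_lambda_beta
  by (intro real_polynomial_function.intros(3) assms real_polynomial_function_sum finite
      real_polynomial_function.intros(4)[OF real_polynomial_function.intros(2) real_polynomial_function_pert_term])

lemma hess_eq_sum:
  assumes "\<And>l. real_polynomial_function (\<lambda>z. p z $ l)"
  shows "hess p z \<eta> $ i $ j = (\<Sum>l\<in>UNIV. \<eta> $ l * mixed_hessian (\<lambda>z. p z $ l) z $ i $ j)"
  by (rule mixed_hessian_sum[OF assms])

text \<open>The Hessian is affine in \<open>c\<close>, so prescribing its entries gives a linear
  system for \<open>c\<close>.\<close>

lemma hess_pert:
  assumes p: "\<And>l. real_polynomial_function (\<lambda>z. p z $ l)"
  shows "hess (pert P n p c) z \<eta> $ i $ j =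
    hess p z \<eta> $ i $ j + (\<Sum>e\<in>UNIV. \<eta> $ fst e * mixed_hessian (pert_term P n e) z $ i $ j * c $ e)"
proof -
  have "mixed_hessian (\<lambda>z. pert P n p c z $ l) z $ i $ j
      = mixed_hessian (\<lambda>z. p z $ l) z $ i $ j
        + (\<Sum>e\<in>UNIV. (if fst e = l then c $ e else 0) * mixed_hessian (pert_term P n e) z $ i $ j)" for l
  proof -
    obtain q h where q: "has_dir_deriv (y_dir j) (\<lambda>z. p z $ l) q" and h: "has_dir_deriv (x_dir i) q h"
      using real_polynomial_function_mixed_hessian[OF p] by metis
    have "\<forall>e. \<exists>q h. has_dir_deriv (y_dir j) (pert_term P n e) q \<and> has_dir_deriv (x_dir i) q h"
      using real_polynomial_function_mixed_hessian[OF real_polynomial_function_pert_term] by (metis (no_types))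
    then obtain q' h' where q': "\<And>e. has_dir_deriv (y_dir j) (pert_term P n e) (q' e)"
      and h': "\<And>e. has_dir_deriv (x_dir i) (q' e) (h' e)" by metis
    have "mixed_hessian (\<lambda>z. pert P n p c z $ l) z $ i $ j
        = h z + (\<Sum>e\<in>UNIV. (if fst e = l then c $ e else 0) * h' e z)"
      unfolding pert_def vec_lambda_beta
      by (rule mixed_hessian_eq[OF
            has_dir_deriv_add[OF q has_dir_deriv_sum[OF has_dir_deriv_cmult[OF q']]]
            has_dir_deriv_add[OF h has_dir_deriv_sum[OF has_dir_deriv_cmult[OF h']]]])
    then show ?thesis by (simp only: mixed_hessian_eq[OF q h] mixed_hessian_eq[OF q' h'])
  qed
  then have "hess (pert P n p c) z \<eta> $ i $ j = (\<Sum>l\<in>UNIV. \<eta> $ l * mixed_hessian (\<lambda>z. p z $ l) z $ i $ j)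
      + (\<Sum>l\<in>UNIV. \<Sum>e\<in>UNIV. \<eta> $ l * ((if fst e = l then c $ e else 0) * mixed_hessian (pert_term P n e) z $ i $ j))"
    by (simp only: hess_eq_sum[OF real_polynomial_function_pert[OF p]] distrib_left sum.distrib sum_distrib_left)
  also have "(\<Sum>l\<in>UNIV. \<Sum>e\<in>UNIV. \<eta> $ l * ((if fst e = l then c $ e else 0) * mixed_hessian (pert_term P n e) z $ i $ j))
      = (\<Sum>e\<in>UNIV. \<Sum>l\<in>UNIV. if fst e = l then \<eta> $ l * (c $ e * mixed_hessian (pert_term P n e) z $ i $ j) else 0)"
    by (subst sum.swap) (intro sum.cong refl, simp)
  also have "\<dots> = (\<Sum>e\<in>UNIV. \<eta> $ fst e * mixed_hessian (pert_term P n e) z $ i $ j * c $ e)"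
    by (intro sum.cong refl) (simp add: mult_ac)
  finally show ?thesis by (simp only: hess_eq_sum[OF p])
qed

text \<open>The hypothesis on \<open>n\<close> gives every added monomial the weight required of the
  component to which it is added.\<close>

lemma pert_in_Lambda:
  assumes p: "p \<in> Lambda \<alpha>' \<alpha>'' \<beta>' \<beta>''"
    and n: "\<And>l i j v. (i, j) \<in> P \<Longrightarrow> \<beta>'' $ l = \<alpha>' $ i + \<beta>' $ j + n (l, (i, j), v) * wt \<alpha>' \<alpha>'' \<beta>' v"
  shows "pert P n p c \<in> Lambda \<alpha>' \<alpha>'' \<beta>' \<beta>''"
proof -
  have "pert_term P n e (dil \<alpha>' \<alpha>'' \<beta>' s z) = 2 powi (s * int (\<beta>'' $ fst e)) * pert_term P n e z" for e s z
  proof -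
    obtain l i j v where e: "e = (l, (i, j), v)" by (cases e) auto
    show ?thesis
    proof (cases "(i, j) \<in> P")
      case True
      have "(2::real) powi (s * int (\<beta>'' $ l)) = 2 powi (s * int (\<alpha>' $ i)) * 2 powi (s * int (\<beta>' $ j))
          * (2 powi (s * int (wt \<alpha>' \<alpha>'' \<beta>' v))) ^ n e"
        unfolding n[OF True, of l v] e
        by (simp add: distrib_left power_int_add power_int_mult[symmetric] power_int_of_nat[symmetric] mult_ac
            del: power_int_of_nat)
      then show ?thesis using True
        by (simp add: e pert_term_def pert_monomial_def crd_dil wt_def power_mult_distrib mult_ac)
    qed (simp add: e pert_term_def)
  qed
  then have hom: "(if fst e = l then c $ e else 0) * pert_term P n e (dil \<alpha>' \<alpha>'' \<beta>' s z)
      = 2 powi (s * int (\<beta>'' $ l)) * ((if fst e = l then c $ e else 0) * pert_term P n e z)" for e s z l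
    by simp
  then show ?thesis
    using p real_polynomial_function_pert[of p _ P n c] unfolding Lambda_iff pert_def vec_lambda_beta
    by (simp only: hom sum_distrib_left[symmetric] distrib_left[symmetric]) (simp add: sum_distrib_left)
qed

section \<open>Parameters for which the rank condition fails\<close>

lemma real_polynomial_function_compose_linear:
  assumes "real_polynomial_function q" "bounded_linear f"
  shows "real_polynomial_function (\<lambda>x. q (f x))"
  using real_polynomial_function_compose[OF polynomial_function_bounded_linear[OF assms(2)] assms(1)]
  by (simp add: o_def)

text \<open>A failure provides a point, a covector and a low-rank representation \<open>w\<close> of
  the Hessian. After fixing \<open>v\<close> with nonzero coordinate, \<open>l\<close> with nonzero
  covector entry, and \<open>J\<close>, each failing \<open>c\<close> solves \<open>card P\<close>
  linear equations whose data depend on fewer than \<open>card P\<close> parameters. Only finitely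
  many choices of \<open>l\<close>, \<open>v\<close> and \<open>J\<close> occur.\<close>

lemma negligible_rank_condition_fails:
  fixes P :: "('m::finite \<times> 'm) set" and n :: "('m, 'k::finite) pert_index \<Rightarrow> nat"
  assumes p: "\<And>l. real_polynomial_function (\<lambda>z. p z $ l)"
    and r: "r \<le> CARD('m)"
    and P: "CARD('m)\<^sup>2 + 2 * (CARD('m) + CARD('k)) < (CARD('m) - r)\<^sup>2 + card P"
  shows "negligible {c. \<not> rank_condition r (pert P n p c)}"
proof -
  \<comment> \<open>Only the position inside \<open>e\<close> matters for the row; the full index is
    kept so that equations and unknowns have the same index type, as in
    \<open>negligible_overdetermined\<close>.\<close>
  define A :: "('m, 'k) pert_index \<Rightarrow> ('m, 'k) pert_index \<Rightarrow> ('m, 'k) pt \<times> (real^'k) \<times> (real^('m \<times> 'm)) \<Rightarrow> real" where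
    "A = (\<lambda>e e' s. fst (snd s) $ fst e' *
      mixed_hessian (pert_term P n e') (fst s) $ fst (fst (snd e)) $ snd (fst (snd e)))"
  define b :: "'m set \<Rightarrow> ('m, 'k) pert_index \<Rightarrow> ('m, 'k) pt \<times> (real^'k) \<times> (real^('m \<times> 'm)) \<Rightarrow> real" where
    "b = (\<lambda>J e s. low_rank J (snd (snd s)) (fst (fst (snd e))) (snd (fst (snd e)))
        - (\<Sum>l\<in>UNIV. fst (snd s) $ l * mixed_hessian (\<lambda>z. p z $ l) (fst s) $ fst (fst (snd e)) $ snd (fst (snd e))))"
  define T :: "'m set \<Rightarrow> (('m, 'k) pt \<times> (real^'k) \<times> (real^('m \<times> 'm))) set" where
    "T J = UNIV \<times> UNIV \<times> {w. \<forall>e. e \<notin> {(i, j). i \<in> J \<or> j \<in> J} \<longrightarrow> w $ e = 0}" for J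
  define S where "S l v J = {s \<in> T J. crd (fst s) v \<noteq> 0 \<and> fst (snd s) $ l \<noteq> 0}" for l v J
  \<comment> \<open>Only the unknowns belonging to \<open>l\<close>, \<open>v\<close> and
    \<open>P\<close> are solved for; the remaining ones are free.\<close>
  define I where "I l v = {e :: ('m, 'k) pert_index. fst e = l \<and> fst (snd e) \<in> P \<and> snd (snd e) = v}" for l v
  define Bad where "Bad l v J = {c. \<exists>s\<in>S l v J. \<forall>e\<in>I l v. (\<Sum>e'\<in>UNIV. A e e' s * c $ e') = b J e s}" for l v J
  have eta: "real_polynomial_function (\<lambda>s :: ('m, 'k) pt \<times> (real^'k) \<times> (real^('m \<times> 'm)). fst (snd s) $ l)" for l
    by (intro real_polynomial_function.intros(1) bounded_linear_compose[OF bounded_linear_vec_nth]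
        bounded_linear_compose[OF bounded_linear_fst] bounded_linear_snd)
  have w: "real_polynomial_function (\<lambda>s :: ('m, 'k) pt \<times> (real^'k) \<times> (real^('m \<times> 'm)). snd (snd s) $ e)" for e
    by (intro real_polynomial_function.intros(1) bounded_linear_compose[OF bounded_linear_vec_nth]
        bounded_linear_compose[OF bounded_linear_snd] bounded_linear_snd)
  have hp: "real_polynomial_function
      (\<lambda>s :: ('m, 'k) pt \<times> (real^'k) \<times> (real^('m \<times> 'm)). mixed_hessian q (fst s) $ i $ j)"
    if "real_polynomial_function q" for q i j
    by (rule real_polynomial_function_compose_linear[OF real_polynomial_function_mixed_hessian_entry[OF that] bounded_linear_fst])
  have neg: "negligible (Bad l v J)" if "card J < r" for l v J
    unfolding Bad_def
  proof (rule negligible_overdetermined[where T = "T J"])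
    show "A e e' differentiable_on S l v J" for e e'
      unfolding A_def
      by (intro differentiable_on_real_polynomial_function real_polynomial_function.intros(4) eta hp
          real_polynomial_function_pert_term)
    have low: "real_polynomial_function (\<lambda>s :: ('m, 'k) pt \<times> (real^'k) \<times> (real^('m \<times> 'm)). low_rank J (snd (snd s)) i j)" for i j
    proof (cases "j \<in> J")
      case True
      then show ?thesis using w by (simp add: low_rank_def)
    next
      case False
      have "real_polynomial_function (\<lambda>s :: ('m, 'k) pt \<times> (real^'k) \<times> (real^('m \<times> 'm)). \<Sum>a\<in>J. snd (snd s) $ (i, a) * snd (snd s) $ (a, j))"
        by (intro real_polynomial_function_sum finite real_polynomial_function.intros(4) w)
      then show ?thesis using False by (simp add: low_rank_def)
    qed
    show "b J e differentiable_on S l v J" for e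
      unfolding b_def
      by (intro differentiable_on_real_polynomial_function real_polynomial_function_diff low
          real_polynomial_function_sum finite real_polynomial_function.intros(4) eta hp p)
    show "S l v J \<subseteq> T J" by (auto simp: S_def)
    let ?W = "{w :: real^('m \<times> 'm). \<forall>e. e \<notin> {(i, j). i \<in> J \<or> j \<in> J} \<longrightarrow> w $ e = 0}"
    have sub: "subspace ?W" by (rule subspace_coordinates)
    show "subspace (T J)"
      unfolding T_def by (intro subspace_Times subspace_UNIV sub)
    \<comment> \<open>The point has \<open>2n' + n''\<close> coordinates and the covector
      \<open>n''\<close>, in total \<open>2n\<close>; the cross contributes the rest.\<close>
    have "dim (T J) = DIM(('m, 'k) pt) + (CARD('k) + dim ?W)"
      unfolding T_def by (simp only: dim_Times subspace_Times subspace_UNIV sub dim_UNIV DIM_cart DIM_real mult_1_right)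
    also have "dim ?W = card {(i, j). i \<in> J \<or> j \<in> J}" by (rule dim_coordinates)
    finally have dim: "dim (T J) = 2 * (CARD('m) + CARD('k)) + card {(i, j). i \<in> J \<or> j \<in> J}" by simp
    have le: "(CARD('m) - r)\<^sup>2 \<le> (CARD('m) - card J)\<^sup>2"
      using \<open>card J < r\<close> by (intro power_mono) auto
    have "card (I l v) = card P"
    proof -
      have "I l v = (\<lambda>e. (l, e, v)) ` P" by (auto simp: I_def image_iff)
      moreover have "inj_on (\<lambda>e. (l, e, v)) P" by (auto simp: inj_on_def)
      ultimately show ?thesis by (simp add: card_image)
    qed
    \<comment> \<open>The count becomes linear arithmetic by treating the squares as atoms;
      \<open>s'\<close> and \<open>s\<close> stand for \<open>(n' - r)^2\<close> and
      \<open>(n' - card J)^2\<close>.\<close>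
    moreover have "a + s = q \<Longrightarrow> s' \<le> s \<Longrightarrow> q + d < s' + c \<Longrightarrow> d + a < c" for a s s' q c d :: nat
      by linarith
    from this[OF card_cross le P] have "dim (T J) < card P" unfolding dim .
    ultimately show "dim (T J) < card (I l v)" by simp
    show "x = (\<lambda>e. 0)"
      if s: "s \<in> S l v J" and x: "\<And>e. e \<notin> I l v \<Longrightarrow> x e = 0"
        and eq: "\<And>e. e \<in> I l v \<Longrightarrow> (\<Sum>e'\<in>UNIV. A e e' s * x e') = 0" for s x
    proof -
      have crd: "crd (fst s) v \<noteq> 0" and eta_l: "fst (snd s) $ l \<noteq> 0" using s by (auto simp: S_def)
      have "x (l, e, v) = 0" if "e \<in> P" for e
      proof (rule pert_monomial_triangular[OF crd _ that, where y = "\<lambda>e. x (l, e, v)" and n = "\<lambda>e. n (l, e, v)"])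
        fix i j assume ij: "(i, j) \<in> P"
        have "I l v = (\<lambda>e. (l, e, v)) ` P" by (auto simp: I_def image_iff)
        moreover have "inj_on (\<lambda>e. (l, e, v)) P" by (auto simp: inj_on_def)
        ultimately have "(\<Sum>e'\<in>I l v. A (l, (i, j), v) e' s * x e') = (\<Sum>e\<in>P. A (l, (i, j), v) (l, e, v) s * x (l, e, v))"
          by (simp add: sum.reindex)
        moreover have "(\<Sum>e'\<in>I l v. A (l, (i, j), v) e' s * x e') = (\<Sum>e'\<in>UNIV. A (l, (i, j), v) e' s * x e')"
          using x by (intro sum.mono_neutral_left) auto
        moreover have "(l, (i, j), v) \<in> I l v" using ij by (simp add: I_def)
        ultimately have "(\<Sum>e\<in>P. A (l, (i, j), v) (l, e, v) s * x (l, e, v)) = 0" using eq by simp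
        moreover have "A (l, (i, j), v) (l, e, v) s
            = fst (snd s) $ l * mixed_hessian (pert_monomial (fst e) (snd e) v (n (l, e, v))) (fst s) $ i $ j" if "e \<in> P" for e
          using that by (simp add: A_def pert_term_def[abs_def])
        ultimately have "fst (snd s) $ l * (\<Sum>e\<in>P. mixed_hessian (pert_monomial (fst e) (snd e) v (n (l, e, v))) (fst s) $ i $ j * x (l, e, v)) = 0"
          by (simp add: sum_distrib_left mult.assoc)
        then show "(\<Sum>e\<in>P. mixed_hessian (pert_monomial (fst e) (snd e) v (n (l, e, v))) (fst s) $ i $ j * x (l, e, v)) = 0"
          using eta_l by simp
      qed
      moreover have "e = (l, fst (snd e), v)" "fst (snd e) \<in> P" if "e \<in> I l v" for e
        using that by (auto simp: I_def prod_eq_iff)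
      ultimately have "x e = 0" for e using x by (cases "e \<in> I l v") metis+
      then show ?thesis by blast
    qed
  qed
  have "{c. \<not> rank_condition r (pert P n p c)} \<subseteq> (\<Union>l. \<Union>v. \<Union>J\<in>{J. card J < r}. Bad l v J)"
  proof clarify
    fix c assume "\<not> rank_condition r (pert P n p c)"
    then obtain z \<eta> where z: "z \<noteq> 0" "\<eta> \<noteq> 0" and rk: "rank (hess (pert P n p c) z \<eta>) < r"
      unfolding rank_condition_def by (auto simp: not_le)
    obtain v where v: "crd z v \<noteq> 0" using z(1) pt_eqI[of z 0] by auto
    obtain l where l: "\<eta> $ l \<noteq> 0" using z(2) by (auto simp: vec_eq_iff)
    obtain J w where J: "card J = rank (hess (pert P n p c) z \<eta>)"
      and w: "\<And>e. e \<notin> {(i, j). i \<in> J \<or> j \<in> J} \<Longrightarrow> w $ e = 0"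
      and H: "\<And>i j. hess (pert P n p c) z \<eta> $ i $ j = low_rank J w i j"
      using ex_low_rank by blast
    have "(z, \<eta>, w) \<in> S l v J" using v l w by (auto simp: S_def T_def)
    moreover have "(\<Sum>e'\<in>UNIV. A e e' (z, \<eta>, w) * c $ e') = b J e (z, \<eta>, w)" for e
      using H[of "fst (fst (snd e))" "snd (fst (snd e))"]
      unfolding hess_pert[OF p] hess_eq_sum[OF p] by (simp add: A_def b_def)
    ultimately have "c \<in> Bad l v J" unfolding Bad_def by blast
    moreover have "card J < r" using J rk by simp
    ultimately show "c \<in> (\<Union>l. \<Union>v. \<Union>J\<in>{J. card J < r}. Bad l v J)" by blast
  qed
  moreover have "negligible (\<Union>l. \<Union>v. \<Union>J\<in>{J. card J < r}. Bad l v J)"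
  proof (rule negligible_Union)
    fix t assume "t \<in> range (\<lambda>l. \<Union>v. \<Union>J\<in>{J. card J < r}. Bad l v J)"
    then obtain l where t: "t = (\<Union>v. \<Union>J\<in>{J. card J < r}. Bad l v J)" by blast
    have "negligible (\<Union>J\<in>{J. card J < r}. Bad l v J)" for v
      by (rule negligible_Union) (auto intro: neg)
    then show "negligible t"
      unfolding t by (intro negligible_Union) auto
  qed simp
  ultimately show ?thesis using negligible_subset by blast
qed

section \<open>Density of the good elements\<close>

lemma negligible_imp_dense:
  fixes S :: "'a::euclidean_space set"
  assumes "negligible S" shows "closure (- S) = UNIV"
  using assms negligible_subset[OF assms interior_subset] open_not_negligible[OF open_interior, of S]
  by (auto simp: closure_interior)

text \<open>Openness is \<open>openin_rank_condition\<close>. For density near \<open>p\<close>, the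
  good parameters are dense, so 0 is a limit of them, and the perturbed element depends continuously
  on \<open>c\<close>, with \<open>c = 0\<close> giving \<open>p\<close>.\<close>

lemma generic_rank_condition:
  fixes \<alpha>' \<beta>' :: "nat ^ 'm::finite" and \<alpha>'' \<beta>'' :: "nat ^ 'k::finite"
  assumes wt: "\<And>v. wt \<alpha>' \<alpha>'' \<beta>' v > 0"
    and n: "\<And>l i j v. (i, j) \<in> P \<Longrightarrow> \<beta>'' $ l = \<alpha>' $ i + \<beta>' $ j + n (l, (i, j), v) * wt \<alpha>' \<alpha>'' \<beta>' v"
    and r: "r \<le> CARD('m)"
    and P: "CARD('m)\<^sup>2 + 2 * (CARD('m) + CARD('k)) < (CARD('m) - r)\<^sup>2 + card P"
  shows "generic (Lambda \<alpha>' \<alpha>'' \<beta>' \<beta>'') (rank_condition r)"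
proof -
  let ?L = "Lambda \<alpha>' \<alpha>'' \<beta>' \<beta>''"
  have "p \<in> closure {p \<in> ?L. rank_condition r p}" if p: "p \<in> ?L" for p
  proof -
    let ?G = "{c. rank_condition r (pert P n p c)}"
    have "\<And>l. real_polynomial_function (\<lambda>z. p z $ l)" using p by (simp add: Lambda_iff)
    then have "closure (- {c. \<not> rank_condition r (pert P n p c)}) = UNIV"
      by (intro negligible_imp_dense negligible_rank_condition_fails r P)
    then have dense: "closure ?G = UNIV" by (simp add: Compl_eq)
    have mem: "pert P n p c \<in> ?L" for c
      by (rule pert_in_Lambda[OF p n])
    have "continuous_on UNIV (pert P n p)"
    proof (intro continuous_on_coordinatewise_then_product continuous_on_cart)
      fix z l
      show "continuous_on UNIV (\<lambda>c. pert P n p c z $ l)"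
        unfolding pert_def vec_lambda_beta
      proof (intro continuous_on_add continuous_on_const continuous_on_sum continuous_on_mult)
        show "continuous_on UNIV (\<lambda>c :: real ^ ('m, 'k) pert_index. if fst e = l then c $ e else 0)" for e
          by (cases "fst e = l") (auto intro: continuous_intros)
      qed
    qed
    then have cont: "continuous_on (closure ?G) (pert P n p)"
      by (rule continuous_on_subset) simp
    have image: "pert P n p ` closure ?G \<subseteq> closure {p \<in> ?L. rank_condition r p}"
    proof (rule image_closure_subset[OF cont closed_closure], rule image_subsetI)
      fix c assume "c \<in> ?G"
      then show "pert P n p c \<in> closure {p \<in> ?L. rank_condition r p}"
        using mem[of c] by (intro subsetD[OF closure_subset]) simp
    qed
    have pert0: "pert P n p 0 = p"
      by (rule ext) (auto simp: pert_def vec_eq_iff intro!: sum.neutral)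
    have "pert P n p 0 \<in> pert P n p ` closure ?G"
      by (rule imageI) (simp only: dense UNIV_I)
    from subsetD[OF image this] show ?thesis by (simp only: pert0)
  qed
  then show ?thesis
    unfolding generic_def using openin_rank_condition[OF wt, of \<beta>'' r]
    by (intro exI[of _ "{p \<in> ?L. rank_condition r p}"] conjI subsetI) simp_all
qed

section \<open>Multiindices in an arithmetic progression\<close>

lemma card_vec_in:
  assumes "finite A"
  shows "card {\<beta> :: 'a ^ 'k::finite. \<forall>i. \<beta> $ i \<in> A} = card A ^ CARD('k)"
proof -
  have "bij_betw vec_lambda (UNIV \<rightarrow>\<^sub>E A) {\<beta> :: 'a ^ 'k. \<forall>i. \<beta> $ i \<in> A}"
    by (rule bij_betwI[where g = vec_nth]) auto
  then have "card {\<beta> :: 'a ^ 'k. \<forall>i. \<beta> $ i \<in> A} = card ((UNIV :: 'k set) \<rightarrow>\<^sub>E A)"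
    by (metis bij_betw_same_card)
  then show ?thesis using assms by (simp add: card_PiE)
qed

text \<open>The set is a product of arithmetic progressions, so the count in a cube is a power of
  the count in one progression, which is at least \<open>(N - B) / K\<close> once
  \<open>N \<ge> B\<close>.\<close>

lemma arithmetic_progression_lower_density:
  fixes B K :: nat
  assumes "B > 0" "K > 0"
  shows "has_lower_density {\<beta> :: nat ^ 'k::finite. \<forall>l. \<exists>t. \<beta> $ l = B + K * t} (1 / real K ^ CARD('k))"
proof -
  let ?E = "{\<beta> :: nat ^ 'k. \<forall>l. \<exists>t. \<beta> $ l = B + K * t}"
  define A where "A N = {b. b \<le> N \<and> (\<exists>t. b = B + K * t)}" for N
  have finA: "finite (A N)" for N by (rule finite_subset[of _ "{..N}"]) (auto simp: A_def)
  have card: "card {\<beta> \<in> ?E. \<forall>i. \<beta> $ i \<le> N} = card (A N) ^ CARD('k)" for N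
  proof -
    have "{\<beta> \<in> ?E. \<forall>i. \<beta> $ i \<le> N} = {\<beta>. \<forall>i. \<beta> $ i \<in> A N}" by (auto simp: A_def)
    then show ?thesis by (simp only: card_vec_in[OF finA])
  qed
  have cardA: "(real N - real B) / real K \<le> real (card (A N))" if "B \<le> N" for N
  proof -
    have sub: "(\<lambda>t. B + K * t) ` {..(N - B) div K} \<subseteq> A N"
    proof (rule image_subsetI)
      fix t assume "t \<in> {..(N - B) div K}"
      then have "K * t \<le> K * ((N - B) div K)" by simp
      also have "\<dots> \<le> N - B" by (rule times_div_less_eq_dividend)
      finally show "B + K * t \<in> A N" using that by (auto simp: A_def)
    qed
    have "inj_on (\<lambda>t. B + K * t) {..(N - B) div K}" using \<open>K > 0\<close> by (auto simp: inj_on_def)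
    then have "card ((\<lambda>t. B + K * t) ` {..(N - B) div K}) = (N - B) div K + 1"
      by (simp add: card_image)
    then have le: "(N - B) div K + 1 \<le> card (A N)"
      using card_mono[OF finA sub] by simp
    \<comment> \<open>The term \<open>t = 0\<close> adds 1 to the number of terms and so compensates
      for the rounding down in \<open>div\<close>.\<close>
    have "N - B \<le> K * ((N - B) div K + 1)"
      using dividend_less_times_div[OF \<open>K > 0\<close>, of "N - B"] by simp
    also have "\<dots> \<le> K * card (A N)" by (rule mult_le_mono2[OF le])
    finally have "real (N - B) \<le> real (K * card (A N))" by (simp only: of_nat_le_iff)
    then show ?thesis using that \<open>K > 0\<close> by (simp add: of_nat_diff field_simps)
  qed
  define a where "a N = (1 / real K - real B / real K * (1 / real N)) ^ CARD('k)" for N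
  have "a \<longlonglongrightarrow> (1 / real K - real B / real K * 0) ^ CARD('k)"
    unfolding a_def by (intro tendsto_intros lim_1_over_n)
  then have "(\<lambda>N. ereal (a N)) \<longlonglongrightarrow> ereal (1 / real K ^ CARD('k))"
    by (simp add: power_one_over)
  then have "ereal (1 / real K ^ CARD('k)) = liminf (\<lambda>N. ereal (a N))"
    by (rule lim_imp_Liminf[OF sequentially_bot, symmetric])
  also have "\<dots> \<le> liminf (\<lambda>N. ereal (real (card {\<beta> \<in> ?E. \<forall>i. \<beta> $ i \<le> N}) / real N ^ CARD('k)))"
  proof (rule Liminf_mono, rule eventually_sequentiallyI)
    fix N assume N: "B \<le> N"
    then have "real N > 0" using \<open>B > 0\<close> by simp
    then have eq: "1 / real K - real B / real K * (1 / real N) = (real N - real B) / real K / real N"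
      using \<open>K > 0\<close> by (simp add: field_simps)
    have "a N = ((real N - real B) / real K / real N) ^ CARD('k)" by (simp only: a_def eq)
    also have "\<dots> \<le> (real (card (A N)) / real N) ^ CARD('k)"
      using N cardA[OF N] by (intro power_mono divide_right_mono) auto
    finally show "ereal (a N) \<le> ereal (real (card {\<beta> \<in> ?E. \<forall>i. \<beta> $ i \<le> N}) / real N ^ CARD('k))"
      unfolding card by (simp add: power_divide)
  qed
  finally show ?thesis
    using \<open>B > 0\<close> by (auto simp: has_lower_density_def) (metis add_gr_0)
qed

text \<open>Otherwise every fibre would be smaller than the average, and the fibres could not cover
  the domain.\<close>

lemma ex_large_fiber:
  fixes f :: "'a::finite \<Rightarrow> 'b"
  shows "\<exists>c \<in> range f. CARD('a) \<le> card (range f) * card {x. f x = c}"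
proof (rule ccontr)
  assume "\<not> ?thesis"
  then have *: "card (range f) * card {x. f x = c} < CARD('a)" if "c \<in> range f" for c
    using that by (meson not_le)
  have "CARD('a) = (\<Sum>c\<in>range f. card {x. f x = c})"
    using sum.image_gen[of UNIV "\<lambda>_. 1 :: nat" f] by simp
  then have "card (range f) * CARD('a) = (\<Sum>c\<in>range f. card (range f) * card {x. f x = c})"
    by (simp add: sum_distrib_left)
  also have "\<dots> < (\<Sum>c\<in>range f. CARD('a))"
    using * by (intro sum_strict_mono) auto
  finally show False by simp
qed

theorem theorem3:
  fixes \<alpha>' \<beta>' :: "nat ^ 'm::finite" and \<alpha>'' :: "nat ^ 'k::finite"
  assumes "\<forall>i. \<alpha>' $ i > 0" and "\<forall>i. \<beta>' $ i > 0" and "\<forall>i. \<alpha>'' $ i > 0"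
  shows "\<exists>E :: (nat ^ 'k) set.
    has_lower_density E (1 / real (K1 \<alpha>' \<alpha>'' \<beta>') ^ CARD('k)) \<and>
    (\<forall>\<beta>''\<in>E. \<forall>r::nat.
       r > 0 \<longrightarrow>
       real r < real CARD('m)
         - sqrt ((1 - 1 / real (K2 \<alpha>' \<alpha>'' \<beta>')) * (real CARD('m))\<^sup>2
                 + 2 * real (CARD('m) + CARD('k))) \<longrightarrow>
       generic (Lambda \<alpha>' \<alpha>'' \<beta>' \<beta>'') (rank_condition r))"
proof -
  define K where "K = K1 \<alpha>' \<alpha>'' \<beta>'"
  have wt: "wt \<alpha>' \<alpha>'' \<beta>' v > 0" for v
    using assms by (simp add: wt_def split: sum.splits)
  have dvdK: "wt \<alpha>' \<alpha>'' \<beta>' v dvd K" for v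
    unfolding K_def K1_def by (rule dvd_Lcm) (simp add: wt_def split: sum.splits)
  have "finite (range (($) \<alpha>') \<union> range (($) \<alpha>'') \<union> range (($) \<beta>'))" by simp
  moreover have "0 \<notin> range (($) \<alpha>') \<union> range (($) \<alpha>'') \<union> range (($) \<beta>')"
    using assms by (auto simp: image_iff)
  ultimately have "K > 0" unfolding K_def K1_def by (metis Lcm_0_iff gr0I)
  define f where "f = (\<lambda>(i, j). (\<alpha>' $ i + \<beta>' $ j) mod K)"
  have K2: "K2 \<alpha>' \<alpha>'' \<beta>' = card (range f)" by (simp add: K2_def f_def K_def)
  obtain c where c: "c \<in> range f" "CARD('m \<times> 'm) \<le> card (range f) * card {e. f e = c}"
    using ex_large_fiber[of f] by blast
  define P where "P = {e. f e = c}"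
  \<comment> \<open>\<open>B\<close> is congruent to \<open>c\<close> modulo \<open>K\<close> and
    exceeds every \<open>\<alpha>' $ i + \<beta>' $ j\<close>, so the differences below are genuine.
    The summand 1 makes \<open>B\<close> positive even for \<open>c = 0\<close>.\<close>
  define B where "B = c + K * (1 + (\<Sum>i\<in>UNIV. \<alpha>' $ i) + (\<Sum>j\<in>UNIV. \<beta>' $ j))"
  have "B > 0" using \<open>K > 0\<close> by (simp add: B_def)
  define E where "E = {\<beta> :: nat ^ 'k. \<forall>l. \<exists>t. \<beta> $ l = B + K * t}"
  have "generic (Lambda \<alpha>' \<alpha>'' \<beta>' \<beta>'') (rank_condition r)"
    if E: "\<beta>'' \<in> E" and r: "real r < real CARD('m)
         - sqrt ((1 - 1 / real (card (range f))) * (real CARD('m))\<^sup>2 + 2 * real (CARD('m) + CARD('k)))"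
    for \<beta>'' r
  proof -
    \<comment> \<open>The division is exact for positions in \<open>P\<close>: \<open>K\<close>
      divides the difference, and every weight divides \<open>K\<close>.\<close>
    define n where "n = (\<lambda>e :: ('m, 'k) pert_index.
      (\<beta>'' $ fst e - (\<alpha>' $ fst (fst (snd e)) + \<beta>' $ snd (fst (snd e)))) div wt \<alpha>' \<alpha>'' \<beta>' (snd (snd e)))"
    have n: "\<beta>'' $ l = \<alpha>' $ i + \<beta>' $ j + n (l, (i, j), v) * wt \<alpha>' \<alpha>'' \<beta>' v" if "(i, j) \<in> P" for l i j v
    proof -
      obtain t where t: "\<beta>'' $ l = B + K * t" using E by (auto simp: E_def)
      have "\<alpha>' $ i \<le> (\<Sum>i\<in>UNIV. \<alpha>' $ i)" "\<beta>' $ j \<le> (\<Sum>j\<in>UNIV. \<beta>' $ j)"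
        by (auto intro: member_le_sum)
      then have "\<alpha>' $ i + \<beta>' $ j \<le> 1 + (\<Sum>i\<in>UNIV. \<alpha>' $ i) + (\<Sum>j\<in>UNIV. \<beta>' $ j)" by linarith
      also have "\<dots> = 1 * (1 + (\<Sum>i\<in>UNIV. \<alpha>' $ i) + (\<Sum>j\<in>UNIV. \<beta>' $ j))" by simp
      also have "\<dots> \<le> K * (1 + (\<Sum>i\<in>UNIV. \<alpha>' $ i) + (\<Sum>j\<in>UNIV. \<beta>' $ j))"
        using \<open>K > 0\<close> by (intro mult_le_mono1) simp
      also have "\<dots> \<le> \<beta>'' $ l" unfolding t B_def by linarith
      finally have le: "\<alpha>' $ i + \<beta>' $ j \<le> \<beta>'' $ l" .
      have mod: "(\<alpha>' $ i + \<beta>' $ j) mod K = c" using that by (simp add: P_def f_def)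
      have "\<beta>'' $ l = c + K * (1 + (\<Sum>i\<in>UNIV. \<alpha>' $ i) + (\<Sum>j\<in>UNIV. \<beta>' $ j) + t)"
        unfolding t B_def by (simp add: distrib_left)
      then have "\<beta>'' $ l mod K = c mod K" by (simp only: mod_mult_self2)
      also have "c mod K = c" unfolding mod[symmetric] by (rule mod_mod_trivial)
      finally have "K dvd \<beta>'' $ l - (\<alpha>' $ i + \<beta>' $ j)"
        using le mod by (metis mod_eq_dvd_iff_nat)
      then have "wt \<alpha>' \<alpha>'' \<beta>' v dvd \<beta>'' $ l - (\<alpha>' $ i + \<beta>' $ j)" using dvdK dvd_trans by blast
      then show ?thesis using le by (simp add: n_def)
    qed
    \<comment> \<open>Squaring the bound on \<open>r\<close> gives \<open>X < (n' - r)^2\<close>.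
      Together with \<open>n'^2 / K2 \<le> card P\<close> from the choice of \<open>c\<close> this
      is the dimension inequality of \<open>generic_rank_condition\<close>.\<close>
    define X where "X = (1 - 1 / real (card (range f))) * (real CARD('m))\<^sup>2 + 2 * real (CARD('m) + CARD('k))"
    have pos: "card (range f) > 0" by (simp add: card_gt_0_iff)
    then have "1 / real (card (range f)) \<le> 1" by simp
    then have "X \<ge> 0" unfolding X_def by (intro add_nonneg_nonneg mult_nonneg_nonneg) auto
    have less: "sqrt X < real CARD('m) - real r" using r unfolding X_def by linarith
    have "r \<le> CARD('m)" using less real_sqrt_ge_zero[OF \<open>X \<ge> 0\<close>] by linarith
    have "X = (sqrt X)\<^sup>2" using \<open>X \<ge> 0\<close> by simp
    also have "\<dots> < (real CARD('m) - real r)\<^sup>2"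
      using less real_sqrt_ge_zero[OF \<open>X \<ge> 0\<close>] by (intro power_strict_mono) auto
    finally have X: "X < (real CARD('m) - real r)\<^sup>2" .
    have "real (CARD('m \<times> 'm)) \<le> real (card (range f) * card P)"
      using c(2) unfolding P_def by (simp only: of_nat_le_iff)
    then have "(real CARD('m))\<^sup>2 / real (card (range f)) \<le> real (card P)"
      using pos by (simp add: power2_eq_square divide_le_eq mult.commute)
    then have "(real CARD('m))\<^sup>2 + 2 * (real CARD('m) + real CARD('k)) < (real CARD('m) - real r)\<^sup>2 + real (card P)"
      using X unfolding X_def by (simp add: left_diff_distrib)
    \<comment> \<open>By \<open>r \<le> n'\<close> the truncated subtraction agrees with the real
      one.\<close>
    then have "real (CARD('m)\<^sup>2 + 2 * (CARD('m) + CARD('k))) < real ((CARD('m) - r)\<^sup>2 + card P)"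
      using \<open>r \<le> CARD('m)\<close> by (simp add: of_nat_diff)
    then have "CARD('m)\<^sup>2 + 2 * (CARD('m) + CARD('k)) < (CARD('m) - r)\<^sup>2 + card P"
      by (simp only: of_nat_less_iff)
    then show ?thesis
      by (intro generic_rank_condition[OF wt n \<open>r \<le> CARD('m)\<close>])
  qed
  moreover have "has_lower_density E (1 / real K ^ CARD('k))"
    unfolding E_def by (rule arithmetic_progression_lower_density[OF \<open>B > 0\<close> \<open>K > 0\<close>])
  ultimately show ?thesis unfolding K2 K_def[symmetric] by blast
qed

end
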